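(* Let $d,n$ be positive integers and let $\lambda\ge 2$ be an integer. For every $\epsilon\in(0,1)$ there is a ReLU network architecture (a fixed topology, depending only on $d,n,\lambda,\epsilon$ and not on the target function) such that for every $f\in\mathcal{F}_{d,n}$ there is an assignment of weights to this architecture, using at most $\lambda$ distinct weight values, whose output $f'$ satisfies $\sup_{\mathbf{x}\in[0,1]^d}|f'(\mathbf{x})-f(\mathbf{x})|\le\epsilon$, and such that: (i) the depth is $\mathcal{O}\left(\lambda\log^{\frac{1}{\lambda-1}}(1/\epsilon)+\log(1/\epsilon)\right)$; (ii) the number of weights is $\mathcal{O}\left(\lambda\log^{\frac{1}{\lambda-1}+1}(1/\epsilon)\,(1/\epsilon)^{d/n}\right)$; (iii) the number of bits needed to store the network is $\mathcal{O}\left(\lambda\log(\lambda)\log^{\frac{1}{\lambda-1}+1}(1/\epsilon)\,(1/\epsilon)^{d/n}\right)$. Here the implied constants depend only on $d$ and $n$.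
   Context: A ReLU network is a feedforward network with activation $\sigma(x)=\max(0,x)$, several input units, hidden units and one output unit, where each unit connects only to units in the next layer; depth is the number of layers. The $\lambda$ distinct weight values may be any real numbers (nonlinear quantization). Each weight is stored with $\log_2(\lambda)$ bits (the index into a codebook), so the number of bits is $\log_2\lambda$ times the number of weights. $\mathcal{F}_{d,n}$ denotes the set of functions $f$ in the Sobolev space $\mathscr{W}^{n,\infty}([0,1]^d)$ with $\max_{\mathbf{n}:|\mathbf{n}|\le n}\operatorname{ess\,sup}_{\mathbf{x}\in[0,1]^d}|D^{\mathbf{n}}f(\mathbf{x})|\le 1$ (weak derivatives, multi-indices $\mathbf{n}$). All logarithms are base 2. *)

theory Defs
  imports "HOL-Analysis.Analysis"
begin

definition partial :: "'d::finite \<Rightarrow> (real^'d \<Rightarrow> real) \<Rightarrow> real^'d \<Rightarrow> real" where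
  "partial i g x = deriv (\<lambda>t. g (x + t *\<^sub>R axis i 1)) 0"

fun Dl :: "'d::finite list \<Rightarrow> (real^'d \<Rightarrow> real) \<Rightarrow> real^'d \<Rightarrow> real" where
  "Dl [] g = g"
| "Dl (i # ds) g = partial i (Dl ds g)"

definition test_fun :: "(real^'d::finite) set \<Rightarrow> (real^'d \<Rightarrow> real) \<Rightarrow> bool" where
  "test_fun U \<phi> \<longleftrightarrow>
     (\<forall>ds. continuous_on UNIV (Dl ds \<phi>) \<and>
           (\<forall>i x. (\<lambda>t. Dl ds \<phi> (x + t *\<^sub>R axis i 1)) differentiable (at 0))) \<and>
     compact (closure {x. \<phi> x \<noteq> 0}) \<and> closure {x. \<phi> x \<noteq> 0} \<subseteq> U"

definition realises :: "'d::finite list \<Rightarrow> ('d \<Rightarrow> nat) \<Rightarrow> bool" where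
  "realises ds \<alpha> \<longleftrightarrow> (\<forall>i. count (mset ds) i = \<alpha> i)"

definition weak_deriv :: "(real^'d::finite) set \<Rightarrow> ('d \<Rightarrow> nat) \<Rightarrow> (real^'d \<Rightarrow> real) \<Rightarrow> (real^'d \<Rightarrow> real) \<Rightarrow> bool" where
  "weak_deriv U \<alpha> f g \<longleftrightarrow>
     set_borel_measurable lborel U g \<and>
     (\<forall>\<phi> ds. test_fun U \<phi> \<longrightarrow> realises ds \<alpha> \<longrightarrow>
        set_integrable lborel U (\<lambda>x. f x * Dl ds \<phi> x) \<and>
        set_integrable lborel U (\<lambda>x. g x * \<phi> x) \<and>
        (LINT x:U|lborel. f x * Dl ds \<phi> x) = (-1) ^ (\<Sum>i\<in>UNIV. \<alpha> i) * (LINT x:U|lborel. g x * \<phi> x))"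

definition sobolev_ball :: "nat \<Rightarrow> (real^'d::finite \<Rightarrow> real) set" where
  "sobolev_ball n = {f. set_borel_measurable lborel (box 0 One) f \<and>
      (\<forall>\<alpha>::'d \<Rightarrow> nat. (\<Sum>i\<in>UNIV. \<alpha> i) \<le> n \<longrightarrow>
         (\<exists>g. weak_deriv (box 0 One) \<alpha> f g \<and>
              (AE x in lborel. x \<in> box 0 One \<longrightarrow> \<bar>g x\<bar> \<le> 1)))}"

text \<open>An architecture: layer widths [w_0, ..., w_L] (w_0 = number of inputs, w_L = 1),
  a set of edges (l,i,j) from unit i of layer l to unit j of layer l+1, and the set of
  units (l,j), l >= 1, that carry a bias. Depth = number of layers.\<close>

datatype arch = Arch (widths: "nat list") (edges: "(nat \<times> nat \<times> nat) set") (biased: "(nat \<times> nat) set")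

definition depth :: "arch \<Rightarrow> nat" where
  "depth A = length (widths A)"

definition wf_arch :: "nat \<Rightarrow> arch \<Rightarrow> bool" where
  "wf_arch d A \<longleftrightarrow> length (widths A) \<ge> 2 \<and> hd (widths A) = d \<and> last (widths A) = 1 \<and>
     edges A \<subseteq> {(l,i,j). Suc l < length (widths A) \<and> i < widths A ! l \<and> j < widths A ! Suc l} \<and>
     biased A \<subseteq> {(l,j). 1 \<le> l \<and> l < length (widths A) \<and> j < widths A ! l}"

definition num_weights :: "arch \<Rightarrow> nat" where
  "num_weights A = card (edges A) + card (biased A)"

definition num_bits :: "nat \<Rightarrow> arch \<Rightarrow> real" where
  "num_bits lam A = log 2 (real lam) * real (num_weights A)"

definition weight_values :: "arch \<Rightarrow> (nat \<Rightarrow> nat \<Rightarrow> nat \<Rightarrow> real) \<Rightarrow> (nat \<Rightarrow> nat \<Rightarrow> real) \<Rightarrow> real set" where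
  "weight_values A W B = (\<lambda>(l,i,j). W l i j) ` edges A \<union> (\<lambda>(l,j). B l j) ` biased A"

fun layer_vals :: "arch \<Rightarrow> (nat \<Rightarrow> nat \<Rightarrow> nat \<Rightarrow> real) \<Rightarrow> (nat \<Rightarrow> nat \<Rightarrow> real) \<Rightarrow> (nat \<Rightarrow> real) \<Rightarrow> nat \<Rightarrow> nat \<Rightarrow> real" where
  "layer_vals A W B x0 0 = x0"
| "layer_vals A W B x0 (Suc l) = (\<lambda>j.
     let z = (\<Sum>i<widths A ! l. if (l,i,j) \<in> edges A then W l i j * layer_vals A W B x0 l i else 0)
             + (if (Suc l, j) \<in> biased A then B (Suc l) j else 0)
     in if Suc l = length (widths A) - 1 then z else max 0 z)"

definition input_enum :: "nat \<Rightarrow> 'd::finite" where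
  "input_enum = (SOME h. bij_betw h {..<CARD('d)} (UNIV::'d set))"

definition net_out :: "arch \<Rightarrow> (nat \<Rightarrow> nat \<Rightarrow> nat \<Rightarrow> real) \<Rightarrow> (nat \<Rightarrow> nat \<Rightarrow> real) \<Rightarrow> real^'d::finite \<Rightarrow> real" where
  "net_out A W B x = layer_vals A W B (\<lambda>j. x $ input_enum j) (length (widths A) - 1) 0"

end

theory Submission
  imports Defs
begin

text \<open>
  Two weight values, \<open>1/4\<close> and \<open>-1/4\<close>, suffice for every \<open>\<lambda>\<close>. Larger coefficients
  come from identical copies of a unit, and the information about \<open>f\<close> sits only in signs: a real
  coefficient is produced digit by digit, the accumulator being halved at each layer while a unit
  without inputs and with bias \<open>\<plusminus>1/4\<close> contributes the next binary digit after the ReLU.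

  The target is first mollified inside a slightly shrunken cube, which keeps all derivatives up to
  order \<open>n\<close> bounded by 1. On the grid of mesh \<open>2^-p\<close> it is then replaced by the sum of local Taylor
  polynomials, weighted by products of hat functions. This sum has \<open>O(2^(pd))\<close> terms, each a product
  of at most \<open>d + n\<close> factors in \<open>[0,1]\<close>, and products reduce to squares, which Yarotsky's sawtooth
  construction approximates exponentially well in the depth. With \<open>2^(-pn)\<close> of order \<open>\<epsilon>\<close> this gives depth
  \<open>O(log(1/\<epsilon>))\<close> and \<open>O(log(1/\<epsilon>) (1/\<epsilon>)^(d/n))\<close> weights, which is below the claimed bounds since
  \<open>\<lambda> L^(1/(\<lambda>-1)) \<ge> 1\<close> for \<open>L = log(1/\<epsilon>) \<ge> 1\<close>.
\<close>

section \<open>Networks with weights plus or minus one quarter\<close>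

text \<open>Every hidden unit passes on a ReLU value, so a negative number can leave a unit only at
  the affine output. This is why the sign of a coefficient waits for the last layer, while its
  modulus is multiplied into the term. With 1, 2, 4, 8 and 16 copies the weight 1/4 yields the
  factors 1/4, 1/2, 1, 2 and 4; the last one undoes a quarter, and 16 is the largest coefficient
  used anywhere. Mollification is needed because the derivatives of f exist only weakly, whereas the
  remainder in Taylor's formula is evaluated at a point. Testing the weak derivatives against the
  kernel transfers their bound to classical derivatives, and the shrinking keeps the support of the
  kernel inside the open cube. The radius depends on the modulus of continuity of f, without any
  rate, but it never enters the network: only Taylor coefficients of modulus at most 1 do.\<close>

type_synonym row = "int list \<times> int"
text \<open>The number is the input width, stored so that parallel composition knows how many zeros
  to pad.\<close>

type_synonym layer = "nat \<times> row list"

definition dot :: "int list \<Rightarrow> real list \<Rightarrow> real" where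
  "dot cs xs = sum_list (map2 (\<lambda>c x. real_of_int c * x) cs xs)"

text \<open>Coefficients and biases are stored in units of the weight \<open>1/4\<close>.\<close>

definition row_val :: "real list \<Rightarrow> row \<Rightarrow> real" where
  "row_val xs r = (dot (fst r) xs + real_of_int (snd r)) / 4"

text \<open>The ReLU acts on every layer here, including the last; the affine output unit is added
  only in \<open>physical_net\<close>.\<close>

definition layer_val :: "layer \<Rightarrow> real list \<Rightarrow> real list" where
  "layer_val l xs = map (\<lambda>r. max 0 (row_val xs r)) (snd l)"

definition net_val :: "layer list \<Rightarrow> real list \<Rightarrow> real list" where
  "net_val N xs = fold layer_val N xs"

text \<open>\<open>g\<close> is 16 for networks with integer coefficients and 1 after duplication.
  The bias bound is 1 in both cases, because a unit carries only one bias.\<close>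

definition layer_ok :: "int \<Rightarrow> nat \<Rightarrow> layer \<Rightarrow> bool" where
  "layer_ok g n l \<longleftrightarrow> fst l = n \<and>
     (\<forall>r\<in>set (snd l). length (fst r) = n \<and> (\<forall>c\<in>set (fst r). \<bar>c\<bar> \<le> g) \<and> \<bar>snd r\<bar> \<le> 1)"

fun net_ok :: "int \<Rightarrow> nat \<Rightarrow> layer list \<Rightarrow> nat \<Rightarrow> bool" where
  "net_ok g n [] k \<longleftrightarrow> n = k"
| "net_ok g n (l # ls) k \<longleftrightarrow> layer_ok g n l \<and> net_ok g (length (snd l)) ls k"

text \<open>The number of edges and biases of weight 1/4 or -1/4 that realise the row: a coefficient
  c takes |c| edges.\<close>

definition row_size :: "row \<Rightarrow> nat" where
  "row_size r = nat (sum_list (map abs (fst r)) + \<bar>snd r\<bar>)"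

definition layer_size :: "layer \<Rightarrow> nat" where
  "layer_size l = sum_list (map row_size (snd l))"

definition net_size :: "layer list \<Rightarrow> nat" where
  "net_size N = sum_list (map layer_size N)"

definition row_abs :: "row \<Rightarrow> row" where
  "row_abs r = (map abs (fst r), \<bar>snd r\<bar>)"

definition layer_abs :: "layer \<Rightarrow> layer" where
  "layer_abs l = (fst l, map row_abs (snd l))"

definition layer_sum :: "layer \<Rightarrow> layer \<Rightarrow> layer" where
  "layer_sum l l' = (fst l + fst l',
     map (\<lambda>r. (fst r @ replicate (fst l') 0, snd r)) (snd l) @
     map (\<lambda>r. (replicate (fst l) 0 @ fst r, snd r)) (snd l'))"

text \<open>Both networks read the same input, so only the first layers share their columns; all
  later layers are block diagonal.\<close>

fun fork :: "layer list \<Rightarrow> layer list \<Rightarrow> layer list" where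
  "fork (l # ls) (l' # ls') = (fst l, snd l @ snd l') # map2 layer_sum ls ls'"
| "fork _ _ = []"

text \<open>Agreement of the absolute values is what makes the topology independent of the parameter \<open>p\<close>:
  an edge or bias is present iff its entry is nonzero.\<close>

definition computes :: "nat \<Rightarrow> nat \<Rightarrow> nat \<Rightarrow> nat \<Rightarrow> ('p \<Rightarrow> real list \<Rightarrow> real list) \<Rightarrow> bool" where
  "computes n k D w F \<longleftrightarrow> (\<exists>N.
     (\<forall>p. net_ok 16 n (N p) k \<and> length (N p) = D \<and> net_size (N p) \<le> w) \<and>
     (\<forall>p q. map layer_abs (N p) = map layer_abs (N q)) \<and>
     (\<forall>p xs. length xs = n \<longrightarrow> (\<forall>x\<in>set xs. 0 \<le> x) \<longrightarrow> net_val (N p) xs = F p xs))"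

section \<open>Evaluation of networks, serial and parallel composition\<close>

lemma dot_Nil [simp]: "dot [] xs = 0" "dot cs [] = 0"
  by (simp_all add: dot_def)

lemma dot_Cons [simp]: "dot (c # cs) (x # xs) = real_of_int c * x + dot cs xs"
  by (simp add: dot_def)

lemma dot_append:
  "length cs = length xs \<Longrightarrow> dot (cs @ ds) (xs @ ys) = dot cs xs + dot ds ys"
  by (induction cs xs rule: list_induct2) auto

lemma dot_zero [simp]: "dot (replicate n 0) xs = 0"
proof (induction n arbitrary: xs)
  case (Suc n) then show ?case by (cases xs) auto
qed simp

lemma dot_conv_sum:
  "length cs = length xs \<Longrightarrow> dot cs xs = (\<Sum>i<length cs. real_of_int (cs ! i) * xs ! i)"
  by (induction cs xs rule: list_induct2) (auto simp: sum.lessThan_Suc_shift simp del: sum.lessThan_Suc)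

lemma net_val_simps [simp]:
  "net_val [] xs = xs" "net_val (l # ls) xs = net_val ls (layer_val l xs)"
  "net_val (M @ N) xs = net_val N (net_val M xs)"
  by (simp_all add: net_val_def)

lemma net_size_simps [simp]:
  "net_size [] = 0" "net_size (l # ls) = layer_size l + net_size ls"
  "net_size (M @ N) = net_size M + net_size N"
  by (simp_all add: net_size_def)

lemma length_layer_val [simp]: "length (layer_val l xs) = length (snd l)"
  by (simp add: layer_val_def)

lemma layer_val_nonneg: "x \<in> set (layer_val l xs) \<Longrightarrow> 0 \<le> x"
  by (auto simp: layer_val_def)

lemma net_val_length: "net_ok g n N k \<Longrightarrow> length xs = n \<Longrightarrow> length (net_val N xs) = k"
  by (induction N arbitrary: n xs) (auto simp: layer_ok_def)

lemma net_val_nonneg: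
  "(\<forall>x\<in>set xs. 0 \<le> x) \<Longrightarrow> x \<in> set (net_val N xs) \<Longrightarrow> 0 \<le> x"
proof (induction N arbitrary: xs)
  case (Cons l N)
  then show ?case using layer_val_nonneg[of _ l xs] by (metis net_val_simps(2))
qed auto

lemma net_ok_append: "net_ok g n M k \<Longrightarrow> net_ok g k N m \<Longrightarrow> net_ok g n (M @ N) m"
  by (induction M arbitrary: n) auto

text \<open>\<open>computes\<close> promises values for nonnegative inputs only; the second network
  may rely on it because networks map nonnegative lists to nonnegative lists.\<close>

lemma computes_seq:
  assumes "computes n k D w F" "computes k m D' w' G"
  shows "computes n m (D + D') (w + w') (\<lambda>p xs. G p (F p xs))"
proof -
  obtain M where M: "\<forall>p. net_ok 16 n (M p) k \<and> length (M p) = D \<and> net_size (M p) \<le> w"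
    "\<forall>p q. map layer_abs (M p) = map layer_abs (M q)"
    "\<forall>p xs. length xs = n \<longrightarrow> (\<forall>x\<in>set xs. 0 \<le> x) \<longrightarrow> net_val (M p) xs = F p xs"
    using assms(1) unfolding computes_def by blast
  obtain N where N: "\<forall>p. net_ok 16 k (N p) m \<and> length (N p) = D' \<and> net_size (N p) \<le> w'"
    "\<forall>p q. map layer_abs (N p) = map layer_abs (N q)"
    "\<forall>p xs. length xs = k \<longrightarrow> (\<forall>x\<in>set xs. 0 \<le> x) \<longrightarrow> net_val (N p) xs = G p xs"
    using assms(2) unfolding computes_def by blast
  show ?thesis unfolding computes_def
  proof (intro exI[of _ "\<lambda>p. M p @ N p"] conjI allI impI)
    fix p q
    show "map layer_abs (M p @ N p) = map layer_abs (M q @ N q)"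
      by (simp only: map_append M(2)[rule_format, of p q] N(2)[rule_format, of p q])
  next
    fix p and xs :: "real list" assume x: "length xs = n" "\<forall>x\<in>set xs. 0 \<le> x"
    have "net_val (M p) xs = F p xs" using M(3) x by blast
    moreover have "length (net_val (M p) xs) = k" using net_val_length M(1) x(1) by blast
    moreover have "\<forall>x\<in>set (net_val (M p) xs). 0 \<le> x" using net_val_nonneg x(2) by blast
    ultimately show "net_val (M p @ N p) xs = G p (F p xs)" using N(3) by simp
  qed (use M(1) N(1) in \<open>auto intro: add_mono net_ok_append\<close>)
qed

text \<open>The size may be relaxed but the depth may not: parallel composition needs equal depths,
  and deepening is the task of \<open>computes_pad\<close>.\<close>

lemma computes_eqI:
  assumes "computes n k D w F" "D = D'" "w \<le> w'"
    and "\<And>p xs. length xs = n \<Longrightarrow> (\<forall>x\<in>set xs. 0 \<le> x) \<Longrightarrow> F p xs = G p xs"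
  shows "computes n k D' w' G"
  using assms unfolding computes_def by (metis (no_types, lifting) le_trans)

lemma computes_layer:
  assumes "\<And>p r. r \<in> set (R p) \<Longrightarrow> length (fst r) = n \<and> (\<forall>c\<in>set (fst r). \<bar>c\<bar> \<le> 16) \<and> \<bar>snd r\<bar> \<le> 1"
    and "\<And>p. length (R p) = k" "\<And>p. sum_list (map row_size (R p)) \<le> w"
    and "\<And>p q. map row_abs (R p) = map row_abs (R q)"
  shows "computes n k 1 w (\<lambda>p xs. map (\<lambda>r. max 0 (row_val xs r)) (R p))"
  unfolding computes_def
proof (intro exI[of _ "\<lambda>p. [(n, R p)]"] conjI allI impI)
  fix p q show "map layer_abs [(n, R p)] = map layer_abs [(n, R q)]"
    using assms(4)[of p q] by (simp add: layer_abs_def)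
qed (use assms in \<open>auto simp: layer_ok_def layer_size_def layer_val_def\<close>)

lemma layer_val_sum:
  assumes "layer_ok g (length xs) l" "layer_ok g (length ys) l'"
  shows "layer_val (layer_sum l l') (xs @ ys) = layer_val l xs @ layer_val l' ys"
  using assms unfolding layer_val_def layer_sum_def layer_ok_def row_val_def
  by (auto simp: dot_append)

lemma layer_ok_sum:
  "layer_ok g n l \<Longrightarrow> layer_ok g n' l' \<Longrightarrow> 0 \<le> g \<Longrightarrow> layer_ok g (n + n') (layer_sum l l')"
  unfolding layer_ok_def layer_sum_def by auto

lemma length_layer_sum: "length (snd (layer_sum l l')) = length (snd l) + length (snd l')"
  by (simp add: layer_sum_def)

lemma row_size_zero [simp]:
  "row_size (cs @ replicate n 0, b) = row_size (cs, b)"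
  "row_size (replicate n 0 @ cs, b) = row_size (cs, b)"
  by (simp_all add: row_size_def sum_list_replicate)

lemma layer_size_sum: "layer_size (layer_sum l l') = layer_size l + layer_size l'"
  by (simp add: layer_size_def layer_sum_def o_def)

lemma layer_abs_sum: "layer_abs (layer_sum l l') = layer_sum (layer_abs l) (layer_abs l')"
  by (simp add: layer_abs_def layer_sum_def row_abs_def)

lemma net_sum:
  assumes "net_ok g n M k" "net_ok g n' N k'" "length M = length N" "0 \<le> g"
  shows "net_ok g (n + n') (map2 layer_sum M N) (k + k')"
    and "length xs = n \<Longrightarrow> length ys = n' \<Longrightarrow>
           net_val (map2 layer_sum M N) (xs @ ys) = net_val M xs @ net_val N ys"
    and "net_size (map2 layer_sum M N) = net_size M + net_size N"
    and "map layer_abs (map2 layer_sum M N) = map2 layer_sum (map layer_abs M) (map layer_abs N)"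
  using assms(3,1,2)
proof (induction M N arbitrary: n n' xs ys rule: list_induct2)
  case (Cons l M l' N)
  { case 1 then show ?case using Cons.IH(1) assms(4)
      by (auto simp: layer_ok_sum length_layer_sum) }
  { case 2 then show ?case using Cons.IH(2) by (auto simp: layer_val_sum) }
  { case 3 then show ?case using Cons.IH(3) by (auto simp: layer_size_sum) }
  { case 4 then show ?case using Cons.IH(4) by (auto simp: layer_abs_sum) }
qed auto

lemma computes_fork:
  assumes "computes n k D w F" "computes n k' D w' G" "D \<ge> 1"
  shows "computes n (k + k') D (w + w') (\<lambda>p xs. F p xs @ G p xs)"
proof -
  obtain M where M: "\<And>p. net_ok 16 n (M p) k" "\<And>p. length (M p) = D" "\<And>p. net_size (M p) \<le> w"
    "\<And>p q. map layer_abs (M p) = map layer_abs (M q)"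
    "\<And>p xs. length xs = n \<Longrightarrow> (\<forall>x\<in>set xs. 0 \<le> x) \<Longrightarrow> net_val (M p) xs = F p xs"
    using assms(1) unfolding computes_def by blast
  obtain N where N: "\<And>p. net_ok 16 n (N p) k'" "\<And>p. length (N p) = D" "\<And>p. net_size (N p) \<le> w'"
    "\<And>p q. map layer_abs (N p) = map layer_abs (N q)"
    "\<And>p xs. length xs = n \<Longrightarrow> (\<forall>x\<in>set xs. 0 \<le> x) \<Longrightarrow> net_val (N p) xs = G p xs"
    using assms(2) unfolding computes_def by blast
  define m ms where "m = (\<lambda>p. hd (M p))" and "ms = (\<lambda>p. tl (M p))"
  define l ls where "l = (\<lambda>p. hd (N p))" and "ls = (\<lambda>p. tl (N p))"
  \<comment> \<open>Depth at least 1 allows the first layer to be split off and joined on the shared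
    input.\<close>
  have Mp: "M p = m p # ms p" for p using M(2)[of p] assms(3) by (cases "M p") (auto simp: m_def ms_def)
  have Np: "N p = l p # ls p" for p using N(2)[of p] assms(3) by (cases "N p") (auto simp: l_def ls_def)
  have len: "length (ms p) = length (ls p)" for p using M(2)[of p] N(2)[of p] Mp Np by simp
  have ok: "layer_ok 16 n (m p)" "net_ok 16 (length (snd (m p))) (ms p) k"
    "layer_ok 16 n (l p)" "net_ok 16 (length (snd (l p))) (ls p) k'" for p
    using M(1)[of p] N(1)[of p] Mp Np by auto
  note ns = net_sum[OF ok(2) ok(4) len]
  show ?thesis unfolding computes_def
  proof (intro exI[of _ "\<lambda>p. fork (M p) (N p)"] conjI allI impI)
    fix p
    show "net_ok 16 n (fork (M p) (N p)) (k + k')"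
      using ns(1)[of p] ok(1,3)[of p] by (auto simp: Mp Np layer_ok_def)
    show "length (fork (M p) (N p)) = D" using M(2)[of p] N(2)[of p] by (simp add: Mp Np)
    show "net_size (fork (M p) (N p)) \<le> w + w'"
      using M(3)[of p] N(3)[of p] ns(3)[of p] by (simp add: Mp Np layer_size_def)
  next
    fix p q
    have "map layer_abs (m p # ms p) = map layer_abs (m q # ms q)"
      "map layer_abs (l p # ls p) = map layer_abs (l q # ls q)"
      using M(4)[of p q] N(4)[of p q] unfolding Mp Np by auto
    then show "map layer_abs (fork (M p) (N p)) = map layer_abs (fork (M q) (N q))"
      using ns(4)[of p] ns(4)[of q] by (simp add: Mp Np) (simp add: layer_abs_def)
  next
    fix p and xs :: "real list" assume x: "length xs = n" "\<forall>x\<in>set xs. 0 \<le> x"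
    have "net_val (fork (M p) (N p)) xs
        = net_val (map2 layer_sum (ms p) (ls p)) (layer_val (m p) xs @ layer_val (l p) xs)"
      by (simp add: Mp Np layer_val_def)
    also have "\<dots> = net_val (M p) xs @ net_val (N p) xs"
      using ns(2) by (simp add: Mp Np)
    finally show "net_val (fork (M p) (N p)) xs = F p xs @ G p xs"
      using M(5)[OF x] N(5)[OF x] by simp
  qed
qed

lemma computes_forks:
  assumes "\<And>t. t < M \<Longrightarrow> computes n 1 D w (\<lambda>p xs. [F t p xs])" "D \<ge> 1" "M \<ge> 1"
  shows "computes n M D (M * w) (\<lambda>p xs. map (\<lambda>t. F t p xs) [0..<M])"
  using assms(3,1)
proof (induction M rule: dec_induct)
  case base then show ?case by simp
next
  case (step M)
  have "computes n (M + 1) D (M * w + w) (\<lambda>p xs. map (\<lambda>t. F t p xs) [0..<M] @ [F M p xs])"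
    by (rule computes_fork) (use step assms(2) in auto)
  then show ?case by (simp add: add.commute)
qed

lemma row_val_1: "row_val [x] ([c], b) = (c * x + b) / 4" by (simp add: row_val_def)
lemma row_val_2: "row_val [x, y] ([c, d], b) = (c * x + d * y + b) / 4" by (simp add: row_val_def)

text \<open>The coefficient 4 is the weight 1, so the row \<open>([4],0)\<close> followed by the
  ReLU is the identity on nonnegative values.\<close>

lemma computes_pad:
  assumes "computes n 1 D w (\<lambda>p xs. [f p xs])" "\<And>p xs. 0 \<le> f p xs" "D \<le> D'"
  shows "computes n 1 D' (w + 4 * (D' - D)) (\<lambda>p xs. [f p xs])"
  using assms(3)
proof (induction D' rule: dec_induct)
  case base then show ?case using assms(1) by simp
next
  case (step m)
  have "computes 1 1 1 4 (\<lambda>p::'a. \<lambda>xs. map (\<lambda>r. max 0 (row_val xs r)) [([4],0)])"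
    by (rule computes_layer) (auto simp: row_size_def)
  from computes_seq[OF step.IH this]
  have "computes n 1 (Suc m) (w + 4 * (m - D) + 4) (\<lambda>p xs. [f p xs])"
    by (simp add: row_val_1 assms(2) max_absorb2)
  then show ?case using step(1) by (simp add: Suc_diff_le algebra_simps)
qed

section \<open>Constants, hat functions and products\<close>

text \<open>Digits come least significant first, since each halving pushes the earlier ones down. A
  digit is worth 1/4, the output of a unit of bias 1/4, so T digits give the nonnegative multiples
  of 1/2^(T+2) below 1/4.\<close>

primrec bits_val :: "(nat \<Rightarrow> bool) \<Rightarrow> nat \<Rightarrow> real" where
  "bits_val \<beta> 0 = 0"
| "bits_val \<beta> (Suc j) = (bits_val \<beta> j + (if \<beta> j then 1 / 4 else 0)) / 2"

lemma bits_val_bounds: "0 \<le> bits_val \<beta> j" "bits_val \<beta> j \<le> 1 / 4"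
  by (induction j) auto

lemma bits_val_odd:
  "bits_val (\<lambda>j. odd (m div 2 ^ j)) T = real (m mod 2 ^ T) / 2 ^ (T + 2)"
proof (induction T)
  case (Suc T)
  have "m mod 2 ^ Suc T = 2 ^ T * (m div 2 ^ T mod 2) + m mod 2 ^ T"
    using mod_mult2_eq[of m "2 ^ T" 2] by (simp add: mult.commute)
  then have "real (m mod 2 ^ Suc T) = 2 ^ T * (if odd (m div 2 ^ T) then 1 else 0) + real (m mod 2 ^ T)"
    by (simp add: odd_iff_mod_2_eq_one)
  then show ?case using Suc by (simp add: field_simps)
qed simp

lemma bits_val_approx:
  assumes "0 \<le> c" "c \<le> 1 / 4"
  shows "\<exists>\<beta>. \<bar>bits_val \<beta> T - c\<bar> \<le> 1 / 2 ^ T"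
proof -
  have "\<exists>m < 2 ^ T. \<bar>real m - c * 2 ^ (T + 2)\<bar> \<le> 1"
  \<comment> \<open>At the endpoint the floor would be 2^T, which needs one digit more; 2^T - 1 is
    still within distance 1.\<close>
  proof (cases "c = 1 / 4")
    case True
    then have e: "c * 2 ^ (T + 2) = 2 ^ T" by simp
    show ?thesis unfolding e by (intro exI[of _ "2 ^ T - 1"]) (simp add: of_nat_diff del: power_add)
  next
    case False
    then have "c * 2 ^ (T + 2) < 2 ^ T" using assms by simp
    then have "\<lfloor>c * 2 ^ (T + 2)\<rfloor> < 2 ^ T" by (simp add: floor_less_iff del: power_add)
    then have "nat \<lfloor>c * 2 ^ (T + 2)\<rfloor> < 2 ^ T" by (simp add: nat_less_iff assms del: power_add)
    moreover have "\<bar>real (nat \<lfloor>c * 2 ^ (T + 2)\<rfloor>) - c * 2 ^ (T + 2)\<bar> \<le> 1"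
      using assms by (simp del: power_add) linarith
    ultimately show ?thesis by blast
  qed
  then obtain m where m: "m < 2 ^ T" "\<bar>real m - c * 2 ^ (T + 2)\<bar> \<le> 1" by blast
  have "bits_val (\<lambda>j. odd (m div 2 ^ j)) T - c = (real m - c * 2 ^ (T + 2)) / 2 ^ (T + 2)"
    unfolding bits_val_odd mod_less[OF m(1)] by (simp add: diff_divide_distrib)
  then have "\<bar>bits_val (\<lambda>j. odd (m div 2 ^ j)) T - c\<bar> = \<bar>real m - c * 2 ^ (T + 2)\<bar> / 2 ^ (T + 2)"
    by (simp add: abs_divide)
  also have "\<dots> \<le> 1 / 2 ^ (T + 2)" using m(2) by (rule divide_right_mono) simp
  also have "\<dots> \<le> 1 / 2 ^ T" by (intro divide_left_mono power_increasing) auto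
  finally show ?thesis by blast
qed

lemma row_val_zeros [simp]: "row_val xs (replicate n 0, b) = b / 4"
  by (simp add: row_val_def)

lemma row_val_3: "row_val [x, y, z] ([c, d, e], b) = (c * x + d * y + e * z + b) / 4"
  by (simp add: row_val_def)

lemma row_val_4: "row_val [x, y, z, u] ([c, d, e, f], b) = (c * x + d * y + e * z + f * u + b) / 4"
  by (simp add: row_val_def)

lemmas row_vals = row_val_1 row_val_2 row_val_3 row_val_4

text \<open>The second entry is the digit for the next layer, so that accumulator and digit meet in
  one halving row \<open>[2, 2]\<close>. A digit 0 is a bias -1/4 cut off by the ReLU rather than a
  missing bias, which keeps the absolute values independent of \<open>p\<close>.\<close>

lemma computes_bits_state:
  "computes n 2 (Suc j) (1 + 5 * j)
     (\<lambda>p xs. [bits_val (\<beta> p) j, if \<beta> p j then 1 / 4 else 0])"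
proof (induction j)
  case 0
  have "computes n 2 1 1 (\<lambda>p xs. map (\<lambda>r. max 0 (row_val xs r))
      [(replicate n 0, 0), (replicate n 0, if \<beta> p 0 then 1 else -1)])"
    by (rule computes_layer) (auto simp: row_size_def row_abs_def sum_list_replicate)
  then show ?case by (rule computes_eqI) auto
next
  case (Suc j)
  have "computes 2 2 1 5 (\<lambda>p xs. map (\<lambda>r. max 0 (row_val xs r))
      [([2, 2], 0), ([0, 0], if \<beta> p (Suc j) then 1 else -1)])"
    by (rule computes_layer) (auto simp: row_size_def row_abs_def)
  from computes_seq[OF Suc this] show ?case
    by (rule computes_eqI)
       (use bits_val_bounds(1)[of "\<beta> _" j] in \<open>auto simp: row_vals field_simps add_nonneg_nonneg\<close>)
qed

lemma computes_bits:
  "computes n 1 (T + 2) (5 * T + 5) (\<lambda>p xs. [bits_val (\<beta> p) T])"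
proof -
  have "computes 2 1 1 4 (\<lambda>p::'a. \<lambda>xs. map (\<lambda>r. max 0 (row_val xs r)) [([4, 0], 0)])"
    by (rule computes_layer) (auto simp: row_size_def)
  from computes_seq[OF computes_bits_state this, of n T \<beta>] show ?thesis
    by (rule computes_eqI)
       (use bits_val_bounds(1)[of "\<beta> _" T] in \<open>auto simp: row_vals\<close>)
qed

section \<open>Coordinates, shifted ReLUs and hat functions\<close>

lemma computes_coord:
  assumes "i < n"
  shows "computes n 1 1 4 (\<lambda>p xs. [max 0 (xs ! i)])"
proof -
  have "sum_list (map abs ((replicate n (0::int))[i := 4])) = 4"
    using assms by (simp add: map_update sum_list_sum_nth nth_list_update if_distrib cong: if_cong)
  then have "computes n 1 1 4 (\<lambda>p::'a. \<lambda>xs. map (\<lambda>r. max 0 (row_val xs r)) [((replicate n 0)[i := 4], 0)])"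
    by (intro computes_layer) (auto simp: row_size_def dest!: set_update_subset_insert[THEN subsetD])
  then show ?thesis
  proof (rule computes_eqI)
    fix xs :: "real list" assume "length xs = n"
    then have "dot ((replicate n 0)[i := 4]) xs = (\<Sum>j<n. if j = i then 4 * xs ! j else 0)"
      using assms by (subst dot_conv_sum, simp, intro sum.cong) (auto simp: nth_list_update)
    also have "\<dots> = 4 * xs ! i" using assms by simp
    finally show "map (\<lambda>r. max 0 (row_val xs r)) [((replicate n 0)[i := 4], 0)] = [max 0 (xs ! i)]"
      by (simp add: row_val_def)
  qed auto
qed

lemma computes_coord_const:
  assumes "i < n" "m \<le> 2 ^ p"
  shows "computes n 2 (p + 3) (9 * p + 22) (\<lambda>_ xs. [real m / 2 ^ (p + 3), max 0 (xs ! i)])"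
proof -
  \<comment> \<open>\<open>p + 1\<close> digits, because \<open>m\<close> may equal 2^p; the price
    is the scale 2^(p+3).\<close>
  have "bits_val (\<lambda>j. odd (m div 2 ^ j)) (p + 1) = real m / 2 ^ (p + 3)"
    using assms(2) by (subst bits_val_odd) (simp add: mod_less le_less_trans numeral_3_eq_3)
  note e = this
  have "computes n 1 (p + 3) (5 * p + 10) (\<lambda>_::'a. \<lambda>_. [real m / 2 ^ (p + 3)])"
    by (rule computes_eqI[OF computes_bits[of n "p + 1" "\<lambda>_ j. odd (m div 2 ^ j)"]])
       (simp_all only: e, simp_all)
  \<comment> \<open>The \<open>max 0\<close> is part of the claim because
    \<open>computes_pad\<close> asks for nonnegativity on all lists.\<close>
  moreover have "computes n 1 (p + 3) (4 + 4 * (p + 3 - 1)) (\<lambda>_::'a. \<lambda>xs. [max 0 (xs ! i)])"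
    by (rule computes_pad[OF computes_coord[OF assms(1)]]) auto
  ultimately have "computes n (1 + 1) (p + 3) (5 * p + 10 + (4 + 4 * (p + 3 - 1)))
      (\<lambda>_::'a. \<lambda>xs. [real m / 2 ^ (p + 3)] @ [max 0 (xs ! i)])"
    by (rule computes_fork) simp
  then show ?thesis
    unfolding one_add_one by (rule computes_eqI) auto
qed

lemma max_0_div_4 [simp]: "max 0 (z / 4) = max 0 z / (4 :: real)"
  by (simp add: max_def)

lemma computes_relu_shift:
  assumes "i < n" "m \<le> 2 ^ p"
  shows "computes n 1 (p + 5) (9 * p + 47) (\<lambda>_ xs. [max 0 (xs ! i - real m / 2 ^ p)])"
proof -
  \<comment> \<open>The coefficient -8 turns the scale 2^(p+3) back into 2^p. The difference comes
    out divided by 4, as the undivided one would need the coefficient -32; the next layer multiplies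
    by 4.\<close>
  have 1: "computes 2 1 1 9 (\<lambda>_::'a. \<lambda>xs. map (\<lambda>r. max 0 (row_val xs r)) [([-8, 1], 0)])"
    by (rule computes_layer) (auto simp: row_size_def)
  have 2: "computes 1 1 1 16 (\<lambda>_::'a. \<lambda>xs. map (\<lambda>r. max 0 (row_val xs r)) [([16], 0)])"
    by (rule computes_layer) (auto simp: row_size_def)
  have e: "4 * max 0 ((max 0 x - 8 * (real m / (2 ^ p * 8))) / 4) = max 0 (x - real m / 2 ^ p)"
    if "0 \<le> x" for x :: real
    using that by (simp add: max_def)
  have "computes n 1 (p + 3 + 1 + 1) (9 * p + 22 + 9 + 16) (\<lambda>_::'a. \<lambda>xs. [max 0 (xs ! i - real m / 2 ^ p)])"
    by (rule computes_eqI[OF computes_seq[OF computes_seq[OF computes_coord_const[OF assms] 1] 2]])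
       (use assms(1) in \<open>auto simp: row_vals power_add e\<close>)
  then show ?thesis by (simp add: numeral_eq_Suc)
qed

lemma computes_hat_state:
  assumes "i < n" "m \<le> 2 ^ p"
  shows "computes n 2 (p + 4 + q) (9 * p + 40 + 16 * q)
    (\<lambda>_ xs. [2 ^ q * (max 0 (xs ! i - real m / 2 ^ p) / 4), 2 ^ q * (max 0 (real m / 2 ^ p - xs ! i) / 4)])"
proof (induction q)
  case 0
  have 1: "computes 2 2 1 18 (\<lambda>_::'a. \<lambda>xs. map (\<lambda>r. max 0 (row_val xs r)) [([-8, 1], 0), ([8, -1], 0)])"
    by (rule computes_layer) (auto simp: row_size_def)
  have e: "max 0 ((max 0 x - 8 * (real m / (2 ^ p * 8))) / 4) = max 0 ((x - real m / 2 ^ p) / 4)"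
     "max 0 ((8 * (real m / (2 ^ p * 8)) - max 0 x) / 4) = max 0 ((real m / 2 ^ p - x) / 4)" if "0 \<le> x" for x :: real
    using that by (simp_all add: max_def)
  have "computes n 2 (p + 3 + 1) (9 * p + 22 + 18) (\<lambda>_::'a. \<lambda>xs. [2 ^ 0 * (max 0 (xs ! i - real m / 2 ^ p) / 4), 2 ^ 0 * (max 0 (real m / 2 ^ p - xs ! i) / 4)])"
    by (rule computes_eqI[OF computes_seq[OF computes_coord_const[OF assms] 1]])
       (use assms(1) in \<open>auto simp: row_vals power_add e\<close>)
  then show ?case by (simp add: numeral_eq_Suc)
next
  case (Suc q)
  have 1: "computes 2 2 1 16 (\<lambda>_::'a. \<lambda>xs. map (\<lambda>r. max 0 (row_val xs r)) [([8, 0], 0), ([0, 8], 0)])"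
    by (rule computes_layer) (auto simp: row_size_def)
  have "computes n 2 (p + 4 + q + 1) (9 * p + 40 + 16 * q + 16) (\<lambda>_::'a. \<lambda>xs. [2 ^ Suc q * (max 0 (xs ! i - real m / 2 ^ p) / 4), 2 ^ Suc q * (max 0 (real m / 2 ^ p - xs ! i) / 4)])"
    by (rule computes_eqI[OF computes_seq[OF Suc 1]]) (auto simp: row_vals)
  then show ?case by (simp add: algebra_simps)
qed

lemma computes_hat:
  assumes "i < n" "m \<le> 2 ^ p"
  shows "computes n 1 (2 * p + 6) (25 * p + 65) (\<lambda>_ xs. [max 0 (1 - \<bar>2 ^ p * xs ! i - real m\<bar>)])"
proof -
  \<comment> \<open>The factor 1/4 left in the state matches the only positive bias available, so
    this row yields a quarter of the hat; the next layer multiplies by 4.\<close>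
  have 1: "computes 2 1 1 9 (\<lambda>_::'a. \<lambda>xs. map (\<lambda>r. max 0 (row_val xs r)) [([-4, -4], 1)])"
    by (rule computes_layer) (auto simp: row_size_def)
  have 2: "computes 1 1 1 16 (\<lambda>_::'a. \<lambda>xs. map (\<lambda>r. max 0 (row_val xs r)) [([16], 0)])"
    by (rule computes_layer) (auto simp: row_size_def)
  have e: "max 0 (- (2 ^ p * max 0 (x - real m / 2 ^ p)) - 2 ^ p * max 0 (real m / 2 ^ p - x) + 1)
      = max 0 (1 - \<bar>2 ^ p * x - real m\<bar>)" for x :: real
  proof -
    have *: "2 ^ p * max 0 (x - real m / 2 ^ p) = max 0 (2 ^ p * x - real m)"
      "2 ^ p * max 0 (real m / 2 ^ p - x) = max 0 (real m - 2 ^ p * x)"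
      by (simp_all add: max_mult_distrib_left right_diff_distrib)
    show ?thesis unfolding * by (simp add: max_def abs_if)
  qed
  have "computes n 1 (p + 4 + p + 1 + 1) (9 * p + 40 + 16 * p + 9 + 16)
      (\<lambda>_::'a. \<lambda>xs. [max 0 (1 - \<bar>2 ^ p * xs ! i - real m\<bar>)])"
    by (rule computes_eqI[OF computes_seq[OF computes_seq[OF computes_hat_state[OF assms] 1] 2]])
       (auto simp: row_vals e)
  then show ?thesis by (simp add: algebra_simps)
qed

text \<open>\<open>4^s * sq_step x s\<close> is the \<open>s\<close>-fold iterate of the tent map at \<open>x\<close>; the scaled form needs only the constant
  \<open>4^-s\<close>, which a network obtains by repeated division. With \<open>g\<close> the tent map, \<open>x(1-x) = (g x + g x (1 - g x)) / 4\<close>,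
  so subtracting the scaled iterates from \<open>x\<close> yields \<open>x\<^sup>2\<close> in the limit.\<close>

primrec sq_step :: "real \<Rightarrow> nat \<Rightarrow> real" where
  "sq_step x 0 = x"
| "sq_step x (Suc s) = max 0 (sq_step x s / 2 - max 0 (sq_step x s - 1 / (2 * 4 ^ s)))"

primrec sq_approx :: "real \<Rightarrow> nat \<Rightarrow> real" where
  "sq_approx x 0 = x"
| "sq_approx x (Suc s) = max 0 (sq_approx x s - sq_step x s / 2 + max 0 (sq_step x s - 1 / (2 * 4 ^ s)))"

text \<open>With y the s-th tent iterate of x, so that \<open>sq_step\<close> is y / 4^s, the excess
  over x^2 is y (1 - y) / 4^s. The tent identity splits it into the next scaled iterate, which is
  subtracted, and a rest of the same form.\<close>

lemma sq_approx_invariant: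
  assumes "0 \<le> x" "x \<le> 1"
  shows "0 \<le> sq_step x s \<and> sq_step x s \<le> 1 / 4 ^ s \<and> sq_approx x s \<le> x \<and>
         sq_approx x s = x\<^sup>2 + sq_step x s * (1 - 4 ^ s * sq_step x s)"
proof (induction s)
  case 0
  then show ?case using assms by (auto simp: power2_eq_square algebra_simps)
next
  case (Suc s)
  define P A K where "P = sq_step x s" "A = sq_approx x s" "K = (4::real) ^ s"
  have K: "K > 0" by (simp add: P_A_K_def)
  have IH: "0 \<le> P" "P \<le> 1 / K" "A \<le> x" "A = x\<^sup>2 + P * (1 - K * P)"
    using Suc by (auto simp: P_A_K_def)
  define P' where "P' = P / 2 - max 0 (P - 1 / (2 * K))"
  have P': "0 \<le> P'" "P' \<le> 1 / (4 * K)" and e: "A - P' = x\<^sup>2 + P' * (1 - 4 * K * P')"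
  proof -
    have "0 \<le> P' \<and> P' \<le> 1 / (4 * K) \<and> A - P' = x\<^sup>2 + P' * (1 - 4 * K * P')"
    \<comment> \<open>The two linear pieces of the tent map, in the scaled variable.\<close>
    proof (cases "P \<le> 1 / (2 * K)")
      case True
      then have p: "P = 2 * P'" by (simp add: P'_def)
      show ?thesis using IH(1) True K unfolding IH(4) p by (auto simp: field_simps)
    next
      case False
      then have p: "P' = 1 / (2 * K) - P / 2" by (simp add: P'_def max_def)
      show ?thesis using IH(2) False K unfolding IH(4) p by (auto simp: field_simps power2_eq_square)
    qed
    then show "0 \<le> P'" "P' \<le> 1 / (4 * K)" "A - P' = x\<^sup>2 + P' * (1 - 4 * K * P')" by auto
  qed
  have "4 * K * P' \<le> 1" using P' K by (simp add: field_simps)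
  then have "0 \<le> A - P'" unfolding e using P'(1) by simp
  moreover have "sq_step x (Suc s) = P'" using P'(1) by (simp add: P'_def P_A_K_def)
  moreover have "sq_approx x (Suc s) = max 0 (A - P')" by (simp add: P'_def P_A_K_def)
  moreover have "(4::real) ^ Suc s = 4 * K" by (simp add: P_A_K_def)
  ultimately show ?case using P' e IH(3) by simp
qed

lemma sq_approx_bounds:
  assumes "0 \<le> x" "x \<le> 1"
  shows "x\<^sup>2 \<le> sq_approx x s" "sq_approx x s \<le> x\<^sup>2 + 1 / 4 ^ s" "sq_approx x s \<le> 1"
proof -
  note i = sq_approx_invariant[OF assms, of s]
  have "4 ^ s * sq_step x s \<le> 1" using i by (simp add: field_simps)
  then have "0 \<le> sq_step x s * (1 - 4 ^ s * sq_step x s)" using i by simp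
  moreover have "sq_step x s * (1 - 4 ^ s * sq_step x s) \<le> sq_step x s * 1"
    using i by (intro mult_left_mono) auto
  ultimately show "x\<^sup>2 \<le> sq_approx x s" "sq_approx x s \<le> x\<^sup>2 + 1 / 4 ^ s" "sq_approx x s \<le> 1"
    using i assms by auto
qed

text \<open>The second unit is the inner ReLU of the step to come, so that one layer per step
  suffices. The last unit, 1/(8 * 4^S), is the threshold of the step after that.\<close>

lemma computes_sq_state:
  "computes 1 4 (S + 2) (27 * S + 27)
     (\<lambda>_ xs. [sq_step (xs ! 0) S, max 0 (sq_step (xs ! 0) S - 1 / (2 * 4 ^ S)), sq_approx (xs ! 0) S, 1 / (8 * 4 ^ S)])"
proof (induction S)
  case 0
  have 1: "computes 1 2 1 5 (\<lambda>_::'a. \<lambda>xs. map (\<lambda>r. max 0 (row_val xs r)) [([4], 0), ([0], 1)])"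
    by (rule computes_layer) (auto simp: row_size_def)
  have 2: "computes 2 4 1 22 (\<lambda>_::'a. \<lambda>xs. map (\<lambda>r. max 0 (row_val xs r))
      [([4, 0], 0), ([4, -8], 0), ([4, 0], 0), ([0, 2], 0)])"
    by (rule computes_layer) (auto simp: row_size_def)
  have "computes 1 4 (1 + 1) (5 + 22)  (\<lambda>_::'a. \<lambda>xs. [sq_step (xs ! 0) 0,
      max 0 (sq_step (xs ! 0) 0 - 1 / (2 * 4 ^ 0)), sq_approx (xs ! 0) 0, 1 / (8 * 4 ^ 0)])"
    by (rule computes_eqI[OF computes_seq[OF 1 2]]) (auto simp: row_vals length_Suc_conv diff_divide_distrib)
  then show ?case by (simp add: numeral_eq_Suc)
next
  case (Suc S)
  have 1: "computes 4 4 1 27 (\<lambda>_::'a. \<lambda>xs. map (\<lambda>r. max 0 (row_val xs r))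
      [([2, -4, 0, 0], 0), ([2, -4, 0, -4], 0), ([-2, 4, 4, 0], 0), ([0, 0, 0, 1], 0)])"
    by (rule computes_layer) (auto simp: row_size_def)
  have "computes 1 4 (S + 2 + 1) (27 * S + 27 + 27) (\<lambda>_::'a. \<lambda>xs. [sq_step (xs ! 0) (Suc S),
      max 0 (sq_step (xs ! 0) (Suc S) - 1 / (2 * 4 ^ Suc S)), sq_approx (xs ! 0) (Suc S), 1 / (8 * 4 ^ Suc S)])"
  proof (rule computes_eqI[OF computes_seq[OF Suc 1]])
    fix xs :: "real list"
    let ?P = "sq_step (xs ! 0) S" and ?A = "sq_approx (xs ! 0) S" and ?k = "1 / (8 * 4 ^ S) :: real"
    let ?Q = "max 0 (?P - 1 / (2 * 4 ^ S))"
    have k: "0 \<le> ?k" "(1::real) / (2 * 4 ^ Suc S) = ?k" "1 / (8 * 4 ^ Suc S) = ?k / 4" by simp_all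
    \<comment> \<open>For nonnegative k, max 0 (max 0 u - k) = max 0 (u - k): the nested ReLU needs
      no layer of its own.\<close>
    have *: "map (\<lambda>r. max 0 (row_val [P, Q, A, k] r))
        [([2, -4, 0, 0], 0), ([2, -4, 0, -4], 0), ([-2, 4, 4, 0], 0), ([0, 0, 0, 1], 0)]
      = [max 0 (P / 2 - Q), max 0 (max 0 (P / 2 - Q) - k), max 0 (A - P / 2 + Q), k / 4]"
      if "0 \<le> k" for P Q A k :: real
      using that by (auto simp: row_vals max_def)
    show "map (\<lambda>r. max 0 (row_val [?P, ?Q, ?A, ?k] r))
        [([2, -4, 0, 0], 0), ([2, -4, 0, -4], 0), ([-2, 4, 4, 0], 0), ([0, 0, 0, 1], 0)]
      = [sq_step (xs ! 0) (Suc S), max 0 (sq_step (xs ! 0) (Suc S) - 1 / (2 * 4 ^ Suc S)),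
         sq_approx (xs ! 0) (Suc S), 1 / (8 * 4 ^ Suc S)]"
      unfolding k(2,3) *[OF k(1)] sq_step.simps sq_approx.simps ..
  qed auto
  then show ?case by (simp add: algebra_simps)
qed

lemma computes_sq: "computes 1 1 (S + 3) (27 * S + 31) (\<lambda>_ xs. [max 0 (sq_approx (xs ! 0) S)])"
proof -
  have 1: "computes 4 1 1 4 (\<lambda>_::'a. \<lambda>xs. map (\<lambda>r. max 0 (row_val xs r)) [([0, 0, 4, 0], 0)])"
    by (rule computes_layer) (auto simp: row_size_def)
  have "computes 1 1 (S + 2 + 1) (27 * S + 27 + 4) (\<lambda>_::'a. \<lambda>xs. [max 0 (sq_approx (xs ! 0) S)])"
    by (rule computes_eqI[OF computes_seq[OF computes_sq_state 1]]) (auto simp: row_vals)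
  then show ?thesis by (simp add: numeral_eq_Suc)
qed

text \<open>\<open>a b = ((a + b) / 2)\<^sup>2 - (\<bar>a - b\<bar> / 2)\<^sup>2\<close>\<close>

definition mult_approx :: "nat \<Rightarrow> real \<Rightarrow> real \<Rightarrow> real" where
  "mult_approx S a b = max 0 (max 0 (sq_approx (max 0 ((a + b) / 2)) S) -
     max 0 (sq_approx (max 0 ((a - b) / 2) + max 0 ((b - a) / 2)) S))"

text \<open>Both squares are approximated from above with error at most 1/4^S, so the error of their
  difference stays within 1/4^S of zero on either side instead of doubling. Cutting off at 0 cannot
  increase it, as a b is nonnegative.\<close>

lemma mult_approx_bounds:
  assumes "0 \<le> a" "a \<le> 1" "0 \<le> b" "b \<le> 1"
  shows "0 \<le> mult_approx S a b" "mult_approx S a b \<le> 1" "\<bar>mult_approx S a b - a * b\<bar> \<le> 1 / 4 ^ S"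
proof -
  define u v where "u = (a + b) / 2" "v = \<bar>a - b\<bar> / 2"
  have u: "max 0 ((a + b) / 2) = u" "0 \<le> u" "u \<le> 1" using assms by (auto simp: u_v_def)
  have v: "max 0 ((a - b) / 2) + max 0 ((b - a) / 2) = v" "0 \<le> v" "v \<le> 1"
    using assms by (auto simp: u_v_def max_def)
  have ab: "a * b = u\<^sup>2 - v\<^sup>2" by (simp add: u_v_def power2_eq_square field_simps)
  have "0 \<le> a * b" using assms by simp
  moreover note sq_approx_bounds[OF u(2,3), of S] sq_approx_bounds[OF v(2,3), of S]
    zero_le_power2[of u] zero_le_power2[of v]
  ultimately show "0 \<le> mult_approx S a b" "mult_approx S a b \<le> 1"
    "\<bar>mult_approx S a b - a * b\<bar> \<le> 1 / 4 ^ S"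
    unfolding mult_approx_def u(1) v(1) ab by linarith+
qed

lemma computes_mult:
  assumes "computes n 1 D w (\<lambda>p xs. [f p xs])" "computes n 1 D w' (\<lambda>p xs. [g p xs])" "D \<ge> 1"
  shows "computes n 1 (D + (S + 7)) (w + w' + 54 * S + 102) (\<lambda>p xs. [mult_approx S (f p xs) (g p xs)])"
proof -
  have 1: "computes 2 3 1 12 (\<lambda>_::'a. \<lambda>xs. map (\<lambda>r. max 0 (row_val xs r))
      [([2, 2], 0), ([2, -2], 0), ([-2, 2], 0)])"
    by (rule computes_layer) (auto simp: row_size_def)
  have 2: "computes 3 2 1 12 (\<lambda>_::'a. \<lambda>xs. map (\<lambda>r. max 0 (row_val xs r)) [([4, 0, 0], 0), ([0, 4, 4], 0)])"
    by (rule computes_layer) (auto simp: row_size_def)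
  have 3: "computes 2 1 (1 + (S + 3)) (4 + (27 * S + 31))
      (\<lambda>_::'a. \<lambda>xs. [max 0 (sq_approx ([max 0 (xs ! i)] ! 0) S)])" if "i < 2" for i
    by (rule computes_seq[OF computes_coord[OF that] computes_sq])
  note 4 = computes_fork[OF 3[of 0] 3[of 1], simplified]
  have 5: "computes 2 1 1 8 (\<lambda>_::'a. \<lambda>xs. map (\<lambda>r. max 0 (row_val xs r)) [([4, -4], 0)])"
    by (rule computes_layer) (auto simp: row_size_def)
  have 6: "computes n 2 D (w + w') (\<lambda>p xs. [f p xs] @ [g p xs])"
    using computes_fork[OF assms] by (simp add: numeral_2_eq_2)
  note 7 = computes_seq[OF computes_seq[OF computes_seq[OF computes_seq[OF 6 1] 2] 4[unfolded numeral_2_eq_2[symmetric]]] 5]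
  show ?thesis
    by (rule computes_eqI[OF 7]) (auto simp: row_vals mult_approx_def diff_divide_distrib add_divide_distrib)
qed

text \<open>The factors are multiplied one after the other, so each has to be carried along to the
  depth of the partial product; the summand \<open>4 * (K * (S + 7))\<close> pays for this. A bound
  \<open>K\<close> in place of the list length makes the cost of every step the same.\<close>

lemma computes_mult_list:
  assumes "computes n 1 D w (\<lambda>p xs. [f p xs])"
    and "\<And>g. g \<in> set gs \<Longrightarrow> computes n 1 D w (\<lambda>p xs. [g p xs]) \<and> (\<forall>p xs. 0 \<le> g p xs)"
    and "D \<ge> 1" "length gs \<le> K"
  shows "computes n 1 (D + length gs * (S + 7)) (w + length gs * (w + 4 * (K * (S + 7)) + 54 * S + 102))
           (\<lambda>p xs. [foldl (mult_approx S) (f p xs) (map (\<lambda>g. g p xs) gs)])"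
  using assms(2,4)
proof (induction gs rule: rev_induct)
  case Nil
  then show ?case using assms(1) by simp
next
  case (snoc g gs)
  let ?k = "length gs" and ?X = "w + 4 * (K * (S + 7)) + 54 * S + 102"
  have 1: "computes n 1 (D + ?k * (S + 7)) (w + ?k * ?X)
      (\<lambda>p xs. [foldl (mult_approx S) (f p xs) (map (\<lambda>g. g p xs) gs)])"
    by (rule snoc.IH) (use snoc.prems in auto)
  have "computes n 1 (D + ?k * (S + 7)) (w + 4 * (D + ?k * (S + 7) - D)) (\<lambda>p xs. [g p xs])"
    by (rule computes_pad) (use snoc.prems(1)[of g] in auto)
  from computes_mult[OF 1 this, of S] assms(3)
  have "computes n 1 (D + ?k * (S + 7) + (S + 7)) (w + ?k * ?X + (w + 4 * (?k * (S + 7))) + 54 * S + 102)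
     (\<lambda>p xs. [foldl (mult_approx S) (f p xs) (map (\<lambda>g. g p xs) (gs @ [g]))])"
    by simp
  moreover have "?k * (S + 7) \<le> K * (S + 7)" using snoc.prems(2) by (intro mult_right_mono) auto
  ultimately show ?case
    by (elim computes_eqI) (simp_all add: algebra_simps)
qed

text \<open>As all factors lie in [0, 1], earlier errors are not amplified, and each multiplication
  adds at most 1/4^S.\<close>

lemma mult_list_bounds:
  assumes "0 \<le> a" "a \<le> 1" "\<And>b. b \<in> set bs \<Longrightarrow> 0 \<le> b \<and> b \<le> 1"
  shows "0 \<le> foldl (mult_approx S) a bs \<and> foldl (mult_approx S) a bs \<le> 1 \<and>
         \<bar>foldl (mult_approx S) a bs - a * prod_list bs\<bar> \<le> length bs / 4 ^ S"
  using assms(3)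
proof (induction bs rule: rev_induct)
  case Nil
  then show ?case using assms by simp
next
  case (snoc b bs)
  let ?f = "foldl (mult_approx S) a bs"
  have IH: "0 \<le> ?f" "?f \<le> 1" "\<bar>?f - a * prod_list bs\<bar> \<le> length bs / 4 ^ S"
    using snoc by auto
  have b: "0 \<le> b" "b \<le> 1" using snoc.prems by auto
  note m = mult_approx_bounds[OF IH(1,2) b, of S]
  have "\<bar>?f * b - a * prod_list bs * b\<bar> = \<bar>?f - a * prod_list bs\<bar> * b"
    using b by (simp add: abs_mult left_diff_distrib[symmetric])
  also have "\<dots> \<le> length bs / 4 ^ S * 1" using IH b by (intro mult_mono) auto
  finally show ?case using m by (auto simp: add_divide_distrib mult.assoc abs_le_iff)
qed

section \<open>Realisation as an architecture\<close>

text \<open>Zero coefficients yield no edge and zero biases no bias, so that 0 never counts as a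
  third weight value.\<close>

definition arch_of :: "nat \<Rightarrow> layer list \<Rightarrow> arch" where
  "arch_of d L = Arch (d # map (length \<circ> snd) L)
     {(l, i, j). l < length L \<and> j < length (snd (L ! l)) \<and>
        i < length (fst (snd (L ! l) ! j)) \<and> fst (snd (L ! l) ! j) ! i \<noteq> 0}
     {(l, j). 1 \<le> l \<and> l \<le> length L \<and> j < length (snd (L ! (l - 1))) \<and>
        snd (snd (L ! (l - 1)) ! j) \<noteq> 0}"

lemma arch_of_abs: "arch_of d (map layer_abs L) = arch_of d L"
  unfolding arch_of_def
  by (auto simp: layer_abs_def row_abs_def comp_def)

lemma net_ok_nth:
  "net_ok g n L k \<Longrightarrow> l < length L \<Longrightarrow> layer_ok g ((n # map (length \<circ> snd) L) ! l) (L ! l)"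
proof (induction L arbitrary: n l)
  case (Cons a L)
  then show ?case by (cases l) auto
qed simp

lemma net_ok_last: "net_ok g n L k \<Longrightarrow> last (n # map (length \<circ> snd) L) = k"
  by (induction L arbitrary: n) auto

lemma wf_arch_of:
  assumes "net_ok g d L 1" "L \<noteq> []"
  shows "wf_arch d (arch_of d L)"
proof -
  have "length (fst (snd (L ! l) ! j)) = (d # map (length \<circ> snd) L) ! l"
    if "l < length L" "j < length (snd (L ! l))" for l j
    using net_ok_nth[OF assms(1) that(1)] that(2) unfolding layer_ok_def by (meson nth_mem)
  moreover have "last (d # map (length \<circ> snd) L) = 1" by (rule net_ok_last[OF assms(1)])
  ultimately show ?thesis
    using assms(2) unfolding wf_arch_def arch_of_def
    by (auto simp: Suc_le_eq nth_Cons' split: if_splits)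
qed

lemma card_nonzero_le: "int (card {i. i < length cs \<and> cs ! i \<noteq> 0}) \<le> sum_list (map abs cs)"
proof -
  have "int (length (filter (\<lambda>c. c \<noteq> 0) cs)) \<le> sum_list (map abs cs)"
    by (induction cs) auto
  then show ?thesis by (simp add: length_filter_conv_card)
qed

text \<open>A nonzero integer entry counts once as a weight, and with its absolute value, hence at
  least once, in \<open>net_size\<close>.\<close>

lemma num_weights_arch_of: "num_weights (arch_of d L) \<le> net_size L"
proof -
  let ?R = "\<lambda>l. snd (L ! l)"
  let ?nz = "\<lambda>l j. {i. i < length (fst (?R l ! j)) \<and> fst (?R l ! j) ! i \<noteq> 0}"
  let ?b = "\<lambda>l. {j. j < length (?R l) \<and> snd (?R l ! j) \<noteq> 0}"
  have e: "edges (arch_of d L) = (\<Union>l<length L. \<Union>j<length (?R l). (\<lambda>i. (l, i, j)) ` ?nz l j)"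
    by (auto simp: arch_of_def)
  have b: "biased (arch_of d L) = (\<Union>l<length L. \<Union>j<length (?R l). if snd (?R l ! j) \<noteq> 0 then {(Suc l, j)} else {})"
  proof (intro set_eqI, clarify)
    fix l j
    show "(l, j) \<in> biased (arch_of d L) \<longleftrightarrow>
        (l, j) \<in> (\<Union>l<length L. \<Union>j<length (?R l). if snd (?R l ! j) \<noteq> 0 then {(Suc l, j)} else {})"
      by (cases l) (auto simp: arch_of_def split: if_splits)
  qed
  have "card (edges (arch_of d L)) \<le> (\<Sum>l<length L. card (\<Union>j<length (?R l). (\<lambda>i. (l, i, j)) ` ?nz l j))"
    unfolding e by (rule card_UN_le) simp
  also have "\<dots> \<le> (\<Sum>l<length L. \<Sum>j<length (?R l). card ((\<lambda>i. (l, i, j)) ` ?nz l j))"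
    by (intro sum_mono card_UN_le) simp
  also have "\<dots> \<le> (\<Sum>l<length L. \<Sum>j<length (?R l). card (?nz l j))"
    by (intro sum_mono card_image_le) simp
  finally have ce: "card (edges (arch_of d L)) \<le> (\<Sum>l<length L. \<Sum>j<length (?R l). card (?nz l j))" .
  have "card (biased (arch_of d L)) \<le>
      (\<Sum>l<length L. card (\<Union>j<length (?R l). if snd (?R l ! j) \<noteq> 0 then {(Suc l, j)} else {}))"
    unfolding b by (rule card_UN_le) simp
  also have "\<dots> \<le> (\<Sum>l<length L. \<Sum>j<length (?R l). card (if snd (?R l ! j) \<noteq> 0 then {(Suc l, j)} else {}))"
    by (intro sum_mono card_UN_le) simp
  finally have cb: "card (biased (arch_of d L)) \<le>
      (\<Sum>l<length L. \<Sum>j<length (?R l). card (if snd (?R l ! j) \<noteq> 0 then {(Suc l, j)} else {}))" .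
  have r: "card (?nz l j) + card (if snd (?R l ! j) \<noteq> 0 then {(Suc l, j)} else {}) \<le> row_size (?R l ! j)" for l j
    using card_nonzero_le[of "fst (?R l ! j)"] unfolding row_size_def by auto
  have "num_weights (arch_of d L) \<le> (\<Sum>l<length L. \<Sum>j<length (?R l).
      card (?nz l j) + card (if snd (?R l ! j) \<noteq> 0 then {(Suc l, j)} else {}))"
    using ce cb unfolding num_weights_def by (simp add: sum.distrib)
  also have "\<dots> \<le> (\<Sum>l<length L. \<Sum>j<length (?R l). row_size (?R l ! j))"
    by (intro sum_mono r)
  also have "\<dots> = net_size L"
    by (simp add: net_size_def layer_size_def sum_list_sum_nth atLeast0LessThan)
  finally show ?thesis .
qed

definition net_W :: "layer list \<Rightarrow> nat \<Rightarrow> nat \<Rightarrow> nat \<Rightarrow> real" where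
  "net_W L l i j = real_of_int (fst (snd (L ! l) ! j) ! i) / 4"

definition net_B :: "layer list \<Rightarrow> nat \<Rightarrow> nat \<Rightarrow> real" where
  "net_B L l j = real_of_int (snd (snd (L ! (l - 1)) ! j)) / 4"

lemma weight_values_arch_of:
  assumes "net_ok 1 d L k"
  shows "weight_values (arch_of d L) (net_W L) (net_B L) \<subseteq> {1 / 4, - 1 / 4}"
proof -
  have u: "real_of_int c / 4 \<in> {1 / 4, - 1 / 4}" if "c \<noteq> 0" "\<bar>c\<bar> \<le> 1" for c :: int
  proof -
    have "c = 1 \<or> c = - 1" using that by auto
    then show ?thesis by auto
  qed
  have "\<bar>fst (snd (L ! l) ! j) ! i\<bar> \<le> 1" if "l < length L" "j < length (snd (L ! l))"
    "i < length (fst (snd (L ! l) ! j))" for l i j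
    using net_ok_nth[OF assms that(1)] that(2,3) unfolding layer_ok_def by (meson nth_mem)
  moreover have "\<bar>snd (snd (L ! l) ! j)\<bar> \<le> 1" if "l < length L" "j < length (snd (L ! l))" for l j
    using net_ok_nth[OF assms that(1)] that(2) unfolding layer_ok_def by (meson nth_mem)
  ultimately have "\<exists>c. v = real_of_int c / 4 \<and> c \<noteq> 0 \<and> \<bar>c\<bar> \<le> 1"
    if "v \<in> weight_values (arch_of d L) (net_W L) (net_B L)" for v
    using that by (auto simp: weight_values_def arch_of_def net_W_def net_B_def)
  then show ?thesis using u by blast
qed

text \<open>Two statements, because \<open>layer_vals\<close> omits the ReLU at the last layer and
  \<open>net_val\<close> never does: below the last layer the two agree, and the final step is
  expressed through \<open>row_val\<close>.\<close>

lemma layer_vals_arch_of: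
  assumes ok: "net_ok g d L k" and xs: "length xs = d" "\<And>j. j < d \<Longrightarrow> x0 j = xs ! j"
  shows "l < length L \<Longrightarrow> j < (d # map (length \<circ> snd) L) ! l \<Longrightarrow>
           layer_vals (arch_of d L) (net_W L) (net_B L) x0 l j = net_val (take l L) xs ! j"
    and "l < length L \<Longrightarrow> j < length (snd (L ! l)) \<Longrightarrow>
           layer_vals (arch_of d L) (net_W L) (net_B L) x0 (Suc l) j =
             (let z = row_val (net_val (take l L) xs) (snd (L ! l) ! j)
              in if Suc l = length L then z else max 0 z)"
proof -
  have w: "widths (arch_of d L) = d # map (length \<circ> snd) L" by (simp add: arch_of_def)
  have take_ok: "l \<le> length L \<Longrightarrow> net_ok g d (take l L) ((d # map (length \<circ> snd) L) ! l)" for l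
    using ok
  proof (induction L arbitrary: d l)
    case (Cons a L) then show ?case by (cases l) auto
  qed auto
  have step: "layer_vals (arch_of d L) (net_W L) (net_B L) x0 (Suc l) j =
             (let z = row_val (net_val (take l L) xs) (snd (L ! l) ! j)
              in if Suc l = length L then z else max 0 z)"
    if IH: "\<And>i. i < (d # map (length \<circ> snd) L) ! l \<Longrightarrow>
        layer_vals (arch_of d L) (net_W L) (net_B L) x0 l i = net_val (take l L) xs ! i"
      and l: "l < length L" and j: "j < length (snd (L ! l))" for l j
  proof -
    let ?n = "(d # map (length \<circ> snd) L) ! l" and ?r = "snd (L ! l) ! j" and ?v = "net_val (take l L) xs"
    have len: "length (fst ?r) = ?n"
      using net_ok_nth[OF ok l] j unfolding layer_ok_def by (meson nth_mem)
    have lenv: "length ?v = ?n" using net_val_length[OF take_ok xs(1)] l by simp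
    have "(\<Sum>i<?n. if (l, i, j) \<in> edges (arch_of d L)
        then net_W L l i j * layer_vals (arch_of d L) (net_W L) (net_B L) x0 l i else 0)
        = (\<Sum>i<?n. real_of_int (fst ?r ! i) * ?v ! i / 4)"
      by (rule sum.cong) (use l j IH len in \<open>auto simp: arch_of_def net_W_def\<close>)
    also have "\<dots> = dot (fst ?r) ?v / 4"
      by (simp add: dot_conv_sum len lenv sum_divide_distrib)
    moreover have "(if (Suc l, j) \<in> biased (arch_of d L) then net_B L (Suc l) j else 0)
        = real_of_int (snd ?r) / 4"
      using l j by (auto simp: arch_of_def net_B_def)
    ultimately have z: "(\<Sum>i<?n. if (l, i, j) \<in> edges (arch_of d L)
        then net_W L l i j * layer_vals (arch_of d L) (net_W L) (net_B L) x0 l i else 0)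
        + (if (Suc l, j) \<in> biased (arch_of d L) then net_B L (Suc l) j else 0) = row_val ?v ?r"
      by (simp add: row_val_def add_divide_distrib)
    have "length (widths (arch_of d L)) - 1 = length L" by (simp add: w)
    then show ?thesis unfolding layer_vals.simps(2) w z Let_def by simp
  qed
  show *: "layer_vals (arch_of d L) (net_W L) (net_B L) x0 l j = net_val (take l L) xs ! j"
    if "l < length L" "j < (d # map (length \<circ> snd) L) ! l" for l j
    using that
  proof (induction l arbitrary: j)
    case 0
    then show ?case by (simp add: xs(2))
  next
    case (Suc l)
    then have "layer_vals (arch_of d L) (net_W L) (net_B L) x0 (Suc l) j =
        max 0 (row_val (net_val (take l L) xs) (snd (L ! l) ! j))"
      using step[of l j] Suc by (simp add: Let_def comp_def)
    then show ?case using Suc by (simp add: take_Suc_conv_app_nth layer_val_def)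
  qed
  show "layer_vals (arch_of d L) (net_W L) (net_B L) x0 (Suc l) j =
             (let z = row_val (net_val (take l L) xs) (snd (L ! l) ! j)
              in if Suc l = length L then z else max 0 z)"
    if "l < length L" "j < length (snd (L ! l))"
    using step * that by blast
qed

section \<open>Integer coefficients through sixteen copies of each unit\<close>

definition dup :: "'a list \<Rightarrow> 'a list" where
  "dup xs = concat (map (replicate 16) xs)"

text \<open>An integer coefficient \<open>c\<close> is realised by unit coefficients on \<open>\<bar>c\<bar>\<close> of the 16 copies of the source.\<close>

definition spread_coeff :: "int \<Rightarrow> int list" where
  "spread_coeff c = replicate (nat \<bar>c\<bar>) (sgn c) @ replicate (16 - nat \<bar>c\<bar>) 0"

definition spread_row :: "row \<Rightarrow> row" where
  "spread_row r = (concat (map spread_coeff (fst r)), snd r)"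

definition spread_layer :: "layer \<Rightarrow> layer" where
  "spread_layer l = (16 * fst l, dup (map spread_row (snd l)))"

lemma dup_simps [simp]: "dup [] = []" "dup (x # xs) = replicate 16 x @ dup xs"
  by (simp_all add: dup_def)

lemma length_dup [simp]: "length (dup xs) = 16 * length xs"
  by (induction xs) auto

lemma set_dup [simp]: "set (dup xs) = set xs"
  by (induction xs) auto

lemma map_dup: "map f (dup xs) = dup (map f xs)"
  by (induction xs) auto

lemma sum_list_dup: "sum_list (dup xs) = 16 * sum_list (xs :: nat list)"
  by (induction xs) (auto simp: sum_list_replicate)

lemma length_spread_coeff: "\<bar>c\<bar> \<le> 16 \<Longrightarrow> length (spread_coeff c) = 16"
  by (simp add: spread_coeff_def)

lemma dot_replicate: "dot (replicate n c) (replicate n x) = real n * of_int c * x"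
  by (induction n) (auto simp: algebra_simps)

lemma dot_spread_coeff:
  assumes "\<bar>c\<bar> \<le> 16"
  shows "dot (spread_coeff c) (replicate 16 x) = of_int c * x"
proof -
  have "replicate 16 x = replicate (nat \<bar>c\<bar>) x @ replicate (16 - nat \<bar>c\<bar>) x"
    using assms by (simp add: replicate_add[symmetric])
  moreover have "real (nat \<bar>c\<bar>) * of_int (sgn c) = of_int c"
    by (simp add: abs_mult_sgn of_nat_nat flip: of_int_mult of_int_abs)
  ultimately show ?thesis
    unfolding spread_coeff_def by (simp add: dot_append dot_replicate)
qed

lemma dot_spread:
  assumes "\<forall>c\<in>set cs. \<bar>c\<bar> \<le> 16" "length cs = length xs"
  shows "dot (concat (map spread_coeff cs)) (dup xs) = dot cs xs"
  using assms(2,1)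
  by (induction cs xs rule: list_induct2) (auto simp: dot_append length_spread_coeff dot_spread_coeff)

lemma length_spread:
  "\<forall>c\<in>set cs. \<bar>c\<bar> \<le> 16 \<Longrightarrow> length (concat (map spread_coeff cs)) = 16 * length cs"
  by (induction cs) (auto simp: length_spread_coeff)

lemma row_val_spread:
  "\<forall>c\<in>set (fst r). \<bar>c\<bar> \<le> 16 \<Longrightarrow> length (fst r) = length xs \<Longrightarrow> row_val (dup xs) (spread_row r) = row_val xs r"
  by (simp add: row_val_def spread_row_def dot_spread)

text \<open>All copies of a unit have the same row and hence the same value, so the duplication is
  inherited by the next layer.\<close>

lemma layer_val_spread:
  assumes "layer_ok 16 (length xs) l"
  shows "layer_val (spread_layer l) (dup xs) = dup (layer_val l xs)"
proof -
  have *: "map (\<lambda>r. max 0 (row_val (dup xs) r)) (map spread_row (snd l)) = map (\<lambda>r. max 0 (row_val xs r)) (snd l)"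
    using assms by (auto simp: layer_ok_def row_val_spread)
  show ?thesis unfolding layer_val_def spread_layer_def snd_conv map_dup * ..
qed

lemma net_val_spread:
  "net_ok 16 (length xs) N k \<Longrightarrow> net_val (map spread_layer N) (dup xs) = dup (net_val N xs)"
  by (induction N arbitrary: xs) (auto simp: layer_val_spread)

lemma spread_row_ok:
  assumes "length (fst r) = n \<and> (\<forall>c\<in>set (fst r). \<bar>c\<bar> \<le> 16) \<and> \<bar>snd r\<bar> \<le> 1"
  shows "length (fst (spread_row r)) = 16 * n \<and> (\<forall>c\<in>set (fst (spread_row r)). \<bar>c\<bar> \<le> 1) \<and> \<bar>snd (spread_row r)\<bar> \<le> 1"
  using assms by (auto simp: spread_row_def length_spread spread_coeff_def abs_sgn_eq)

lemma net_ok_spread: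
  "net_ok 16 n N k \<Longrightarrow> net_ok 1 (16 * n) (map spread_layer N) (16 * k)"
proof (induction N arbitrary: n)
  case (Cons l N)
  then have r: "length (fst r) = n \<and> (\<forall>c\<in>set (fst r). \<bar>c\<bar> \<le> 16) \<and> \<bar>snd r\<bar> \<le> 1"
    if "r \<in> set (snd l)" for r
    using that by (auto simp: layer_ok_def)
  have "layer_ok 1 (16 * n) (spread_layer l)"
    using Cons.prems spread_row_ok[OF r] by (auto simp: layer_ok_def spread_layer_def)
  then show ?case using Cons by (simp add: spread_layer_def)
qed auto

lemma row_size_spread:
  assumes "\<forall>c\<in>set (fst r). \<bar>c\<bar> \<le> 16"
  shows "row_size (spread_row r) = row_size r"
proof -
  have c: "sum_list (map abs (spread_coeff c)) = \<bar>c\<bar>" for c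
    by (simp add: spread_coeff_def sum_list_replicate abs_sgn_eq)
  have "sum_list (map abs (concat (map spread_coeff cs))) = sum_list (map abs cs)" for cs
    by (induction cs) (auto simp: c)
  then show ?thesis by (simp add: row_size_def spread_row_def)
qed

text \<open>The factor 16 comes from the copies of the rows alone, since \<open>row_size\<close>
  already charges |c| for a coefficient c.\<close>

lemma net_size_spread: "net_ok 16 n N k \<Longrightarrow> net_size (map spread_layer N) = 16 * net_size N"
proof (induction N arbitrary: n)
  case (Cons l N)
  have *: "map row_size (map spread_row (snd l)) = map row_size (snd l)"
    using Cons.prems by (auto simp: layer_ok_def row_size_spread)
  have "layer_size (spread_layer l) = 16 * layer_size l"
    unfolding layer_size_def spread_layer_def snd_conv map_dup * sum_list_dup ..
  then show ?case using Cons by auto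
qed simp

lemma layer_abs_spread: "layer_abs (spread_layer l) = spread_layer (layer_abs l)"
proof -
  have c: "map abs (spread_coeff c) = spread_coeff \<bar>c\<bar>" for c
    by (simp add: spread_coeff_def abs_sgn_eq sgn_if)
  have "row_abs (spread_row r) = spread_row (row_abs r)" for r
    by (simp add: row_abs_def spread_row_def map_concat c o_def)
  then show ?thesis by (simp add: layer_abs_def spread_layer_def map_dup o_def)
qed

definition scale_layer :: "nat \<Rightarrow> int \<Rightarrow> layer" where
  "scale_layer d g = (d, map (\<lambda>i. ((replicate d 0)[i := g], 0)) [0..<d])"

lemma sum_list_unit: "i < d \<Longrightarrow> sum_list (map abs ((replicate d 0)[i := g])) = \<bar>g :: int\<bar>"
  by (simp add: map_update sum_list_sum_nth nth_list_update if_distrib cong: if_cong)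

lemma dot_unit:
  "i < length xs \<Longrightarrow> dot ((replicate (length xs) 0)[i := g]) xs = of_int g * xs ! i"
  by (subst dot_conv_sum) (auto simp: nth_list_update if_distrib if_distribR cong: if_cong)

lemma scale_layer_ok: "\<bar>g\<bar> \<le> h \<Longrightarrow> layer_ok h d (scale_layer d g)"
  by (auto simp: layer_ok_def scale_layer_def dest!: set_update_subset_insert[THEN subsetD])

lemma layer_val_scale:
  assumes "\<forall>x\<in>set xs. 0 \<le> x" "0 \<le> g"
  shows "layer_val (scale_layer (length xs) g) xs = map (\<lambda>x. of_int g * x / 4) xs"
  by (rule nth_equalityI) (use assms in \<open>auto simp: layer_val_def scale_layer_def row_val_def dot_unit max_absorb2\<close>)

lemma layer_size_scale: "layer_size (scale_layer d g) = d * nat \<bar>g\<bar>"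
proof -
  have "map row_size (snd (scale_layer d g)) = map (\<lambda>_. nat \<bar>g\<bar>) [0..<d]"
    by (auto simp: scale_layer_def row_size_def sum_list_unit)
  then show ?thesis by (simp add: layer_size_def sum_list_triv)
qed

text \<open>Inputs are not duplicated, so the first layer can only pass on \<open>x/4\<close>; the second restores \<open>x\<close>.\<close>

definition physical_net :: "nat \<Rightarrow> layer list \<Rightarrow> (nat \<Rightarrow> bool) \<Rightarrow> nat \<Rightarrow> layer list" where
  "physical_net d N s M =
     (d, dup (snd (scale_layer d 1))) # map spread_layer (scale_layer d 16 # N) @
     [(16 * M, [spread_row (map (\<lambda>t. if s t then 16 else - 16) [0..<M], 0)])]"

lemma physical_net_ok:
  assumes "net_ok 16 d N M"
  shows "net_ok 1 d (physical_net d N s M) 1"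
proof -
  have "net_ok 1 (16 * M) [(16 * M, [spread_row (map (\<lambda>t. if s t then 16 else - 16) [0..<M], 0)])] 1"
  proof -
    let ?z = "(map (\<lambda>t. if s t then 16 else - 16) [0..<M], 0) :: row"
    have "length (fst ?z) = M \<and> (\<forall>c\<in>set (fst ?z). \<bar>c\<bar> \<le> 16) \<and> \<bar>snd ?z\<bar> \<le> 1" by auto
    from spread_row_ok[OF this] show ?thesis by (simp add: layer_ok_def)
  qed
  moreover have "net_ok 16 d (scale_layer d 16 # N) M"
    using assms by (simp add: scale_layer_ok) (simp add: scale_layer_def)
  note net_ok_spread[OF this]
  ultimately have "net_ok 1 (16 * d) (map spread_layer (scale_layer d 16 # N) @
     [(16 * M, [spread_row (map (\<lambda>t. if s t then 16 else - 16) [0..<M], 0)])]) 1"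
    by (rule net_ok_append[rotated])
  moreover have "layer_ok 1 d (d, dup (snd (scale_layer d 1)))" "length (dup (snd (scale_layer d 1))) = 16 * d"
    using scale_layer_ok[of 1 1 d] by (auto simp: layer_ok_def scale_layer_def)
  ultimately show ?thesis unfolding physical_net_def by simp
qed

lemma physical_net_size:
  assumes "net_ok 16 d N M"
  shows "net_size (physical_net d N s M) = 272 * d + 16 * net_size N + 16 * M"
proof -
  have "net_ok 16 d (scale_layer d 16 # N) M"
    using assms by (simp add: scale_layer_ok) (simp add: scale_layer_def)
  note 1 = net_size_spread[OF this]
  have 2: "layer_size (d, dup (snd (scale_layer d 1))) = 16 * d"
    using layer_size_scale[of d 1] by (simp add: layer_size_def map_dup sum_list_dup)
  have "row_size (spread_row (map (\<lambda>t. if s t then 16 else - 16) [0..<M], 0)) =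
        row_size (map (\<lambda>t. if s t then 16 else - 16) [0..<M], 0)"
    by (rule row_size_spread) auto
  also have "\<dots> = 16 * M"
    by (simp add: row_size_def if_distrib o_def sum_list_triv cong: if_cong)
  finally have 3: "layer_size (16 * M, [spread_row (map (\<lambda>t. if s t then 16 else - 16) [0..<M], 0)]) = 16 * M"
    by (simp add: layer_size_def)
  show ?thesis unfolding physical_net_def using 1 2 3 layer_size_scale[of d 16] by simp
qed

text \<open>The coefficients 16 and -16 occupy the same 16 edges, so the sign pattern
  \<open>s\<close> does not touch the topology.\<close>

lemma physical_net_abs:
  assumes "map layer_abs N = map layer_abs N'"
  shows "map layer_abs (physical_net d N s M) = map layer_abs (physical_net d N' s' M)"
proof -
  have "map layer_abs (map spread_layer K) = map spread_layer (map layer_abs K)" for K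
    by (simp add: layer_abs_spread)
  then have "map layer_abs (map spread_layer N) = map layer_abs (map spread_layer N')"
    using assms by metis
  moreover have "layer_abs (16 * M, [spread_row (map (\<lambda>t. if s t then 16 else - 16) [0..<M], 0)]) =
     layer_abs (16 * M, [spread_row (map (\<lambda>t. if s' t then 16 else - 16) [0..<M], 0)])"
    by (auto simp: layer_abs_def row_abs_def spread_row_def map_concat spread_coeff_def intro!: arg_cong[of _ _ concat])
  ultimately show ?thesis unfolding physical_net_def by simp
qed

definition coords :: "real ^ 'd::finite \<Rightarrow> real list" where
  "coords x = map (\<lambda>j. x $ input_enum j) [0..<CARD('d)]"

text \<open>The output coefficients 16 and -16 are the weights 4 and -4: the sign is that of a
  Taylor coefficient, and 4 compensates the range [0, 1/4] of \<open>bits_val\<close>.\<close>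

lemma net_out_physical_net:
  fixes x :: "real ^ 'd::finite" and s :: "nat \<Rightarrow> bool"
  assumes ok: "net_ok 16 CARD('d) N M" and x: "\<And>i. 0 \<le> x $ i"
  defines "L \<equiv> physical_net CARD('d) N s M"
  shows "net_out (arch_of CARD('d) L) (net_W L) (net_B L) x =
    (\<Sum>t<M. (if s t then 4 else - 4) * net_val N (coords x) ! t)"
proof -
  let ?d = "CARD('d)"
  let ?z = "(map (\<lambda>t. if s t then 16 else - 16) [0..<M], 0) :: row"
  have len: "length (coords x) = ?d" and nn: "\<forall>y\<in>set (coords x). 0 \<le> y"
    using x by (auto simp: coords_def)
  define m where "m = length N + 2"
  have lenL: "length L = Suc m" by (simp add: L_def physical_net_def m_def)
  have last: "L ! m = (16 * M, [spread_row ?z])"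
    by (simp add: L_def physical_net_def nth_append m_def)
  have tk: "take m L = (?d, dup (snd (scale_layer ?d 1))) # map spread_layer (scale_layer ?d 16 # N)"
    by (simp add: L_def physical_net_def m_def)
  have okL: "net_ok 1 ?d L 1" unfolding L_def by (rule physical_net_ok[OF ok])
  have "layer_val (?d, dup (snd (scale_layer ?d 1))) (coords x) = dup (map (\<lambda>x. x / 4) (coords x))"
    using layer_val_scale[OF nn, of 1] unfolding len
    by (simp add: layer_val_def map_dup)
  moreover have "layer_val (scale_layer ?d 16) (map (\<lambda>x. x / 4) (coords x)) = coords x"
    using layer_val_scale[of "map (\<lambda>x. x / 4) (coords x)" 16] nn by (simp add: len o_def)
  moreover have "net_ok 16 ?d (scale_layer ?d 16 # N) M"
    using ok by (simp add: scale_layer_ok) (simp add: scale_layer_def)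
  ultimately have v: "net_val (take m L) (coords x) = dup (net_val N (coords x))"
    unfolding tk using net_val_spread[of "map (\<lambda>x. x / 4) (coords x)" "scale_layer ?d 16 # N" M]
    by (simp add: len)
  have lenN: "length (net_val N (coords x)) = M" by (rule net_val_length[OF ok len])
  have "net_out (arch_of ?d L) (net_W L) (net_B L) x =
      layer_vals (arch_of ?d L) (net_W L) (net_B L) (\<lambda>j. x $ input_enum j) (Suc m) 0"
    unfolding net_out_def by (simp add: arch_of_def lenL del: layer_vals.simps)
  also have "\<dots> = row_val (dup (net_val N (coords x))) (spread_row ?z)"
    by (subst layer_vals_arch_of(2)[OF okL len])
       (simp_all add: last v lenL, simp add: coords_def)
  also have "\<dots> = row_val (net_val N (coords x)) ?z"
    by (rule row_val_spread) (auto simp: lenN)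
  also have "\<dots> = (\<Sum>t<M. (if s t then 4 else - 4) * net_val N (coords x) ! t)"
    unfolding row_val_def by (simp add: dot_conv_sum lenN sum_divide_distrib if_distrib cong: if_cong)
      (auto intro!: sum.cong)
  finally show ?thesis .
qed

theorem computes_imp_arch:
  assumes "\<And>t. t < M \<Longrightarrow> computes CARD('d::finite) 1 D w (\<lambda>p xs. [F t p xs])" "M \<ge> 1" "D \<ge> 1"
  shows "\<exists>A. wf_arch CARD('d) A \<and> depth A = D + 4 \<and>
     num_weights A \<le> 272 * CARD('d) + 16 * (M * w) + 16 * M \<and>
     (\<forall>p s. \<exists>W B. weight_values A W B \<subseteq> {1 / 4, - 1 / 4} \<and>
        (\<forall>x :: real ^ 'd. (\<forall>i. 0 \<le> x $ i) \<longrightarrow>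
           net_out A W B x = (\<Sum>t<M. (if s t then 4 else - 4) * F t p (coords x))))"
proof -
  let ?d = "CARD('d)"
  have "computes ?d M D (M * w) (\<lambda>p xs. map (\<lambda>t. F t p xs) [0..<M])"
    by (rule computes_forks) (use assms in auto)
  then obtain N where N: "\<And>p. net_ok 16 ?d (N p) M" "\<And>p. length (N p) = D" "\<And>p. net_size (N p) \<le> M * w"
    "\<And>p q. map layer_abs (N p) = map layer_abs (N q)"
    "\<And>p xs. length xs = ?d \<Longrightarrow> (\<forall>x\<in>set xs. 0 \<le> x) \<Longrightarrow> net_val (N p) xs = map (\<lambda>t. F t p xs) [0..<M]"
    unfolding computes_def by blast
  define L where "L p s = physical_net ?d (N p) s M" for p s
  \<comment> \<open>The parameters are arbitrary here; the next step shows that every choice gives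
    the same architecture.\<close>
  define A where "A = arch_of ?d (L undefined undefined)"
  have A: "A = arch_of ?d (L p s)" for p s
    unfolding A_def L_def
    by (subst (1 2) arch_of_abs[symmetric]) (rule arg_cong[OF physical_net_abs[OF N(4)]])
  have ok: "net_ok 1 ?d (L p s) 1" for p s
    unfolding L_def by (rule physical_net_ok[OF N(1)])
  have len: "length (L p s) = D + 3" for p s by (simp add: L_def physical_net_def N(2))
  have "wf_arch ?d A" unfolding A_def by (rule wf_arch_of[OF ok]) (use len[of undefined undefined] in auto)
  moreover have "depth A = D + 4" by (simp add: A_def depth_def arch_of_def len)
  moreover have "num_weights A \<le> 272 * ?d + 16 * (M * w) + 16 * M"
    using num_weights_arch_of[of ?d "L undefined undefined"] N(3)[of undefined]
    unfolding A_def L_def physical_net_size[OF N(1)] by linarith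
  moreover have "\<exists>W B. weight_values A W B \<subseteq> {1 / 4, - 1 / 4} \<and>
        (\<forall>x :: real ^ 'd. (\<forall>i. 0 \<le> x $ i) \<longrightarrow>
           net_out A W B x = (\<Sum>t<M. (if s t then 4 else - 4) * F t p (coords x)))" for p s
  proof (intro exI conjI allI impI)
    show "weight_values A (net_W (L p s)) (net_B (L p s)) \<subseteq> {1 / 4, - 1 / 4}"
      unfolding A[of p s] by (rule weight_values_arch_of[OF ok])
    fix x :: "real ^ 'd" assume x: "\<forall>i. 0 \<le> x $ i"
    then have "net_val (N p) (coords x) = map (\<lambda>t. F t p (coords x)) [0..<M]"
      by (intro N(5)) (auto simp: coords_def)
    then show "net_out A (net_W (L p s)) (net_B (L p s)) x = (\<Sum>t<M. (if s t then 4 else - 4) * F t p (coords x))"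
      using net_out_physical_net[OF N(1), of x p s] x unfolding A[of p s] L_def by simp
  qed
  ultimately show ?thesis by blast
qed

section \<open>Smoothing and Taylor expansion\<close>

lemma exp_minus_le_power:
  assumes "w \<ge> (0::real)" "N \<ge> 1"
  shows "w ^ N * exp (- w) \<le> real N ^ N"
proof -
  have "w / N \<le> exp (w / N)" using exp_ge_add_one_self[of "w / N"] by linarith
  then have "(w / N) ^ N \<le> exp (w / N) ^ N" using assms by (intro power_mono) auto
  also have "\<dots> = exp w" using assms by (simp add: exp_of_nat_mult[symmetric])
  finally have "w ^ N \<le> exp w * real N ^ N" using assms by (simp add: power_divide field_simps)
  then have "w ^ N * exp (- w) \<le> exp w * real N ^ N * exp (- w)" by (intro mult_right_mono) auto
  also have "\<dots> = real N ^ N" by (simp add: exp_minus field_simps)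
  finally show ?thesis .
qed

lemma DERIV_zero_if_quadratic:
  fixes f :: "real \<Rightarrow> real"
  assumes "\<And>x. \<bar>f x\<bar> \<le> C * (x - a)\<^sup>2"
  shows "(f has_real_derivative 0) (at a)"
proof -
  have fa: "f a = 0" using assms[of a] by simp
  have "((\<lambda>x. (f x - f a) / (x - a)) \<longlongrightarrow> 0) (at a)"
  proof (rule Lim_null_comparison)
    show "\<forall>\<^sub>F x in at a. norm ((f x - f a) / (x - a)) \<le> C * \<bar>x - a\<bar>"
      unfolding eventually_at_filter
      using assms fa by (intro always_eventually) (auto simp: abs_divide field_simps power2_eq_square abs_mult_self_eq)
    show "((\<lambda>x. C * \<bar>x - a\<bar>) \<longlongrightarrow> 0) (at a)"
      by (auto intro!: tendsto_eq_intros)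
  qed
  then show ?thesis by (simp add: has_field_derivative_iff)
qed

text \<open>The k-th derivative of exp(-1/u) is \<open>bump_poly u k\<close> / u^(2k) times
  exp(-1/u); the recursion is the quotient rule brought to this denominator.\<close>

primrec bump_poly :: "real poly \<Rightarrow> nat \<Rightarrow> real poly" where
  "bump_poly u 0 = 1"
| "bump_poly u (Suc k) = pderiv (bump_poly u k) * u ^ 2
     - smult (real (2 * k)) (bump_poly u k * pderiv u * u) + bump_poly u k * pderiv u"

lemma bump_exists:
  fixes \<delta> :: real
  assumes "\<delta> > 0"
  obtains \<beta> :: "nat \<Rightarrow> real \<Rightarrow> real" where
    "\<And>k t. (\<beta> k has_real_derivative \<beta> (Suc k) t) (at t)"
    "\<And>k t. \<not> (0 < t \<and> t < \<delta>) \<Longrightarrow> \<beta> k t = 0" "\<And>t. 0 < t \<Longrightarrow> t < \<delta> \<Longrightarrow> 0 < \<beta> 0 t"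
proof -
  define u :: "real poly" where "u = [:0, \<delta>, - 1:]"
  have u: "poly u t = t * (\<delta> - t)" for t by (simp add: u_def algebra_simps)
  have upos: "poly u t > 0" if "0 < t" "t < \<delta>" for t using that by (simp add: u)
  define q where "q = bump_poly u"
  define \<beta> where "\<beta> k t = (if 0 < t \<and> t < \<delta> then
    poly (q k) t * inverse (poly u t) ^ (2 * k) * exp (- inverse (poly u t)) else 0)" for k t
  have \<beta>_zero: "\<beta> k t = 0" if "\<not> (0 < t \<and> t < \<delta>)" for k t
    unfolding \<beta>_def by (rule if_not_P[OF that])
  have "(\<beta> k has_real_derivative \<beta> (Suc k) t) (at t)" for k t
  proof (cases "0 < t \<and> t < \<delta>")
    case True
    define w where "w = inverse (poly u t)"
    have wu: "w * poly u t = 1" "poly u t \<noteq> 0" using upos[of t] True by (auto simp: w_def)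
    have dw: "((\<lambda>t. inverse (poly u t)) has_real_derivative - poly (pderiv u) t * w ^ 2) (at t)"
      using wu(2) by (auto intro!: derivative_eq_intros simp: w_def power2_eq_square)
    have dp: "((\<lambda>t. inverse (poly u t) ^ m) has_real_derivative - (real m * poly (pderiv u) t * w ^ Suc m)) (at t)" for m
      using DERIV_power[OF dw, of m] by (cases m) (auto simp: w_def power2_eq_square algebra_simps)
    have de: "((\<lambda>t. exp (- inverse (poly u t))) has_real_derivative exp (- w) * (poly (pderiv u) t * w ^ 2)) (at t)"
      using DERIV_fun_exp[OF DERIV_minus[OF dw]] by (simp add: w_def)
    have "((\<lambda>t. poly (q k) t * inverse (poly u t) ^ (2 * k) * exp (- inverse (poly u t)))
       has_real_derivative
        (poly (q k) t * w ^ (2 * k)) * (exp (- w) * (poly (pderiv u) t * w ^ 2))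
        + (poly (q k) t * - (real (2 * k) * poly (pderiv u) t * w ^ Suc (2 * k)) + poly (pderiv (q k)) t * w ^ (2 * k)) * exp (- w)) (at t)"
      by (rule derivative_eq_intros poly_DERIV dp de refl | simp add: w_def)+
    also have "(poly (q k) t * w ^ (2 * k)) * (exp (- w) * (poly (pderiv u) t * w ^ 2))
        + (poly (q k) t * - (real (2 * k) * poly (pderiv u) t * w ^ Suc (2 * k)) + poly (pderiv (q k)) t * w ^ (2 * k)) * exp (- w)
        = w ^ (2 * k) * exp (- w) * (poly (pderiv (q k)) t * ((poly u t)\<^sup>2 * w\<^sup>2)
           - real (2 * k) * (poly (q k) t * poly (pderiv u) t) * (poly u t * w\<^sup>2)
           + poly (q k) t * poly (pderiv u) t * w\<^sup>2)"
    proof -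
      have "(poly u t)\<^sup>2 * w\<^sup>2 = (w * poly u t)\<^sup>2" "poly u t * w\<^sup>2 = (w * poly u t) * w"
        by (simp_all add: power2_eq_square)
      then have "(poly u t)\<^sup>2 * w\<^sup>2 = 1" "poly u t * w\<^sup>2 = w" unfolding wu(1) by simp_all
      then show ?thesis by (simp add: algebra_simps)
    qed
    also have "\<dots> = (poly (pderiv (q k)) t * (poly u t)\<^sup>2 - real (2 * k) * (poly (q k) t * poly (pderiv u) t * poly u t)
           + poly (q k) t * poly (pderiv u) t) * (w ^ (2 * k) * w\<^sup>2) * exp (- w)"
      by (simp add: algebra_simps)
    also have "\<dots> = \<beta> (Suc k) t"
      using True by (simp add: \<beta>_def q_def w_def power_add[symmetric] del: of_nat_mult)
    finally show ?thesis
      by (rule has_field_derivative_transform_within_open[of _ _ _ "{0<..<\<delta>}"])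
         (use True in \<open>auto simp: \<beta>_def\<close>)
  next
    case False
    \<comment> \<open>At a point t outside the open interval the derivative has to vanish. For such
      t and x inside, u(x) is at most \<delta> |x - t|, so it suffices to bound
      \<open>\<beta> k x\<close> by a multiple of u(x)^2.\<close>
    have "bounded (poly (q k) ` {0..\<delta>})"
      by (intro compact_imp_bounded compact_continuous_image continuous_intros) auto
    then obtain B where "\<forall>t\<in>{0..\<delta>}. \<bar>poly (q k) t\<bar> \<le> B"
      unfolding bounded_iff by auto
    then have B: "\<bar>poly (q k) t\<bar> \<le> B" if "t \<in> {0..\<delta>}" for t using that by blast
    have B0: "B \<ge> 0" using B[of 0] assms by auto
    \<comment> \<open>The exponential absorbs the pole of order 2k and two further powers of 1/u,
      which leaves a factor u^2.\<close>
    define N where "N = 2 * k + 2"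
    define C where "C = B * (real N ^ N * \<delta>\<^sup>2)"
    have C0: "C \<ge> 0" using B0 by (simp add: C_def)
    have "\<bar>\<beta> k x\<bar> \<le> C * (x - t)\<^sup>2" for x
    proof (cases "0 < x \<and> x < \<delta>")
      case x: True
      define w where "w = inverse (poly u x)"
      have w: "w > 0" "poly u x * w = 1" using upos[of x] x by (auto simp: w_def)
      have "w ^ (2 * k) * exp (- w) = (poly u x * w)\<^sup>2 * w ^ (2 * k) * exp (- w)"
        unfolding w(2) by simp
      also have "\<dots> = (poly u x)\<^sup>2 * (w ^ N * exp (- w))"
        by (simp add: N_def power_add power_mult_distrib power2_eq_square)
      also have "\<dots> \<le> (poly u x)\<^sup>2 * real N ^ N"
        using exp_minus_le_power[of w N] w by (intro mult_left_mono) (auto simp: N_def)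
      also have "\<dots> \<le> (\<delta> * \<bar>x - t\<bar>)\<^sup>2 * real N ^ N"
      proof (intro mult_right_mono power_mono)
        show "poly u x \<le> \<delta> * \<bar>x - t\<bar>"
        proof (cases "t \<le> 0")
          case True
          then have "x * (\<delta> - x) \<le> \<bar>x - t\<bar> * \<delta>" using x by (intro mult_mono) auto
          then show ?thesis by (simp add: u mult.commute)
        next
          case F: False
          then have "x * (\<delta> - x) \<le> \<delta> * \<bar>x - t\<bar>" using x False by (intro mult_mono) auto
          then show ?thesis by (simp add: u)
        qed
      qed (use upos[of x] x in auto)
      finally have *: "w ^ (2 * k) * exp (- w) \<le> (\<delta> * \<bar>x - t\<bar>)\<^sup>2 * real N ^ N" .
      have "\<bar>poly (q k) x\<bar> * (w ^ (2 * k) * exp (- w)) \<le> B * ((\<delta> * \<bar>x - t\<bar>)\<^sup>2 * real N ^ N)"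
        by (rule mult_mono[OF _ * B0]) (use B[of x] x w in auto)
      then show ?thesis
        using x w by (simp add: \<beta>_def abs_mult w_def C_def power_mult_distrib algebra_simps)
    next
      case False
      then show ?thesis using C0 by (auto simp: \<beta>_def)
    qed
    from DERIV_zero_if_quadratic[OF this] show ?thesis unfolding \<beta>_zero[OF False] .
  qed
  moreover note \<beta>_zero
  moreover have "0 < \<beta> 0 t" if "0 < t" "t < \<delta>" for t
    using that by (simp add: \<beta>_def q_def)
  ultimately show ?thesis by (rule that)
qed

text \<open>The partial derivative along \<open>ds\<close> of the product kernel, with
  \<open>\<beta> k\<close> standing for the k-th derivative of \<open>\<beta> 0\<close>: each
  coordinate factor is differentiated as often as its index occurs in the list.\<close>

definition bump_prod :: "(nat \<Rightarrow> real \<Rightarrow> real) \<Rightarrow> 'd::finite list \<Rightarrow> real ^ 'd \<Rightarrow> real" where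
  "bump_prod \<beta> ds z = (\<Prod>i\<in>UNIV. \<beta> (count (mset ds) i) (z $ i))"

lemma bump_prod_DERIV:
  fixes v :: "real ^ 'd::finite"
  assumes \<beta>: "\<And>k t. (\<beta> k has_real_derivative \<beta> (Suc k) t) (at t)"
    and z: "\<And>i. ((\<lambda>t. z t $ i) has_real_derivative v $ i) (at t)"
  shows "((\<lambda>t. bump_prod \<beta> ds (z t)) has_real_derivative (\<Sum>i\<in>UNIV. v $ i * bump_prod \<beta> (i # ds) (z t))) (at t)"
proof -
  let ?c = "count (mset ds)"
  have "((\<lambda>t. \<beta> (?c i) (z t $ i)) has_derivative (\<lambda>y. \<beta> (Suc (?c i)) (z t $ i) * v $ i * y)) (at t)" for i
    using DERIV_chain2[OF \<beta> z] by (simp add: has_field_derivative_def)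
  then have "((\<lambda>t. bump_prod \<beta> ds (z t)) has_derivative
      (\<lambda>y. \<Sum>i\<in>UNIV. (\<beta> (Suc (?c i)) (z t $ i) * v $ i * y) * (\<Prod>j\<in>UNIV - {i}. \<beta> (?c j) (z t $ j)))) (at t)"
    unfolding bump_prod_def by (intro has_derivative_prod)
  moreover have "bump_prod \<beta> (i # ds) (z t) = \<beta> (Suc (?c i)) (z t $ i) * (\<Prod>j\<in>UNIV - {i}. \<beta> (?c j) (z t $ j))" for i
    unfolding bump_prod_def by (subst prod.remove[of _ i]) auto
  ultimately show ?thesis
    unfolding has_field_derivative_def
    by (elim has_derivative_eq_rhs) (auto simp: fun_eq_iff sum_distrib_right sum_distrib_left algebra_simps intro!: sum.cong)
qed

lemma continuous_on_bump_prod: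
  assumes "\<And>k t. (\<beta> k has_real_derivative \<beta> (Suc k) t) (at t)" "continuous_on S g"
  shows "continuous_on S (\<lambda>x. bump_prod \<beta> ds (g x))"
proof -
  have c: "continuous_on UNIV (\<beta> k)" for k
    using assms(1) by (meson DERIV_continuous_on has_field_derivative_at_within)
  show ?thesis unfolding bump_prod_def
    by (intro continuous_on_prod continuous_on_compose2[OF c] continuous_on_vec_lambda continuous_intros assms) auto
qed

lemma One_vec_nth [simp]: "(One :: real ^ 'd::finite) $ i = 1"
  by (simp add: cart_eq_inner_axis)

text \<open>Each derivative in y brings a factor -1 from the reflection; this is the same sign that
  \<open>weak_deriv\<close> carries from integration by parts.\<close>

lemma Dl_reflected_bump:
  fixes x :: "real ^ 'd::finite"
  assumes \<beta>: "\<And>k t. (\<beta> k has_real_derivative \<beta> (Suc k) t) (at t)"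
  shows "Dl ds (\<lambda>y. bump_prod \<beta> [] (x - y)) = (\<lambda>y. (- 1) ^ length ds * bump_prod \<beta> ds (x - y))"
    and "((\<lambda>t. Dl ds (\<lambda>y. bump_prod \<beta> [] (x - y)) (y + t *\<^sub>R axis i 1)) has_real_derivative
           (- 1) ^ Suc (length ds) * bump_prod \<beta> (i # ds) (x - y)) (at 0)"
proof -
  have D: "((\<lambda>t. (- 1) ^ length ds * bump_prod \<beta> ds (x - (y + t *\<^sub>R axis i 1))) has_real_derivative
           (- 1) ^ Suc (length ds) * bump_prod \<beta> (i # ds) (x - y)) (at 0)" for ds i y
  proof -
    have "((\<lambda>t. bump_prod \<beta> ds (x - (y + t *\<^sub>R axis i 1))) has_real_derivative
        (\<Sum>j\<in>UNIV. (- axis i 1) $ j * bump_prod \<beta> (j # ds) (x - (y + 0 *\<^sub>R axis i 1)))) (at 0)"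
      by (rule bump_prod_DERIV[of \<beta>, OF \<beta>]) (auto intro!: derivative_eq_intros)
    also have "(\<Sum>j\<in>UNIV. (- axis i 1) $ j * bump_prod \<beta> (j # ds) (x - (y + 0 *\<^sub>R axis i 1)))
       = (\<Sum>j\<in>UNIV. if j = i then - bump_prod \<beta> (i # ds) (x - y) else 0)"
      by (rule sum.cong) (auto simp: axis_def)
    finally show ?thesis by (auto intro: DERIV_cmult_right[THEN DERIV_cong] dest: DERIV_cmult[where c = "(- 1) ^ length ds"])
  qed
  show *: "Dl ds (\<lambda>y. bump_prod \<beta> [] (x - y)) = (\<lambda>y. (- 1) ^ length ds * bump_prod \<beta> ds (x - y))" for ds
  proof (induction ds)
    case (Cons i ds)
    show ?case
      unfolding Dl.simps Cons partial_def using DERIV_imp_deriv[OF D] by simp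
  qed simp
  show "((\<lambda>t. Dl ds (\<lambda>y. bump_prod \<beta> [] (x - y)) (y + t *\<^sub>R axis i 1)) has_real_derivative
           (- 1) ^ Suc (length ds) * bump_prod \<beta> (i # ds) (x - y)) (at 0)"
    unfolding * by (rule D)
qed

text \<open>The bump lives on (0, \<delta>), so the reflected kernel is supported between x -
  \<delta> and x in each coordinate; hence the one-sided margin required of x.\<close>

lemma test_fun_reflected_bump:
  fixes x :: "real ^ 'd::finite"
  assumes \<beta>: "\<And>k t. (\<beta> k has_real_derivative \<beta> (Suc k) t) (at t)"
    "\<And>k t. \<not> (0 < t \<and> t < \<delta>) \<Longrightarrow> \<beta> k t = 0"
    and x: "\<And>i. \<delta> < x $ i \<and> x $ i < 1"
  shows "test_fun (box 0 One) (\<lambda>y. bump_prod \<beta> [] (x - y))"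
proof -
  have sub: "{y. bump_prod \<beta> [] (x - y) \<noteq> 0} \<subseteq> cbox (x - (\<chi> i. \<delta>)) x"
  proof
    fix y assume "y \<in> {y. bump_prod \<beta> [] (x - y) \<noteq> 0}"
    then have "\<beta> 0 ((x - y) $ i) \<noteq> 0" for i by (auto simp: bump_prod_def)
    then have "0 < (x - y) $ i \<and> (x - y) $ i < \<delta>" for i using \<beta>(2) by blast
    then show "y \<in> cbox (x - (\<chi> i. \<delta>)) x"
      by (auto simp: mem_box_cart less_imp_le algebra_simps)
  qed
  have cl: "closure {y. bump_prod \<beta> [] (x - y) \<noteq> 0} \<subseteq> cbox (x - (\<chi> i. \<delta>)) x"
    by (rule closure_minimal[OF sub closed_cbox])
  have "compact (closure {y. bump_prod \<beta> [] (x - y) \<noteq> 0})"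
    using compact_cbox sub by (meson bounded_cbox bounded_subset compact_closure)
  moreover have "closure {y. bump_prod \<beta> [] (x - y) \<noteq> 0} \<subseteq> box 0 One"
  proof
    fix y assume "y \<in> closure {y. bump_prod \<beta> [] (x - y) \<noteq> 0}"
    then have "y \<in> cbox (x - (\<chi> i. \<delta>)) x" using cl by blast
    then have "x $ i - \<delta> \<le> y $ i \<and> y $ i \<le> x $ i" for i by (simp add: mem_box_cart)
    then have "0 < y $ i \<and> y $ i < 1" for i using x[of i] by (smt (verit))
    then show "y \<in> box 0 One" by (simp add: mem_box_cart One_vec_nth del: sum_component)
  qed
  moreover have "(\<lambda>t. Dl ds (\<lambda>y. bump_prod \<beta> [] (x - y)) (y + t *\<^sub>R axis i 1)) differentiable (at 0)" for ds y i
    using Dl_reflected_bump(2)[of \<beta>, OF \<beta>(1)] real_differentiable_def by blast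
  moreover have "continuous_on UNIV (Dl ds (\<lambda>y. bump_prod \<beta> [] (x - y)))" for ds
    unfolding Dl_reflected_bump(1)[of \<beta>, OF \<beta>(1)]
    by (intro continuous_intros continuous_on_bump_prod[of \<beta>, OF \<beta>(1)])
  ultimately show ?thesis unfolding test_fun_def by blast
qed

lemma sum_count_mset: "(\<Sum>i\<in>(UNIV :: 'd::finite set). count (mset ds) i) = length ds"
proof -
  have "(\<Sum>i\<in>(UNIV :: 'd set). count (mset ds) i) = size (mset ds)"
    unfolding size_multiset_overloaded_eq by (rule sum.mono_neutral_right) (auto simp: count_eq_zero_iff)
  then show ?thesis by simp
qed

lemma set_integrable_box_continuous:
  fixes h :: "real ^ 'd::finite \<Rightarrow> real"
  assumes "continuous_on (cbox a b) h"
  shows "set_integrable lborel (box a b) h"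
proof (rule set_integrable_subset[of lborel "cbox a b"])
  show "set_integrable lborel (cbox a b) h"
    unfolding set_integrable_def by (rule borel_integrable_compact[OF compact_cbox assms])
qed (auto simp: box_subset_cbox)

text \<open>The derivatives move from the kernel to f, where they become a weak derivative of
  modulus at most 1 almost everywhere; what remains of the kernel is nonnegative.\<close>

lemma weak_deriv_convolution_bound:
  fixes x :: "real ^ 'd::finite"
  assumes f: "f \<in> sobolev_ball n" "continuous_on (cbox 0 One) f"
    and \<beta>: "\<And>k t. (\<beta> k has_real_derivative \<beta> (Suc k) t) (at t)"
    "\<And>k t. \<not> (0 < t \<and> t < \<delta>) \<Longrightarrow> \<beta> k t = 0" "\<And>t. 0 \<le> \<beta> 0 t"
    and x: "\<And>i. \<delta> < x $ i \<and> x $ i < 1" and n: "length ds \<le> n"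
  shows "\<bar>integral (cbox 0 One) (\<lambda>y. f y * bump_prod \<beta> ds (x - y))\<bar>
       \<le> integral (cbox 0 One) (\<lambda>y. bump_prod \<beta> [] (x - y))"
proof -
  let ?U = "box 0 One :: (real ^ 'd) set" and ?\<phi> = "\<lambda>y. bump_prod \<beta> [] (x - y)"
  let ?h = "\<lambda>y. f y * bump_prod \<beta> ds (x - y)"
  have LINT: "(LINT y:?U|lborel. h y) = integral (cbox 0 One) h" if "continuous_on (cbox 0 One) h" for h :: "real ^ 'd \<Rightarrow> real"
    using set_borel_integral_eq_integral(2)[OF set_integrable_box_continuous[OF that]]
    by (simp add: integral_open_interval)
  obtain g where g: "weak_deriv ?U (count (mset ds)) f g" "AE y in lborel. y \<in> ?U \<longrightarrow> \<bar>g y\<bar> \<le> 1"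
  proof -
    have "\<forall>\<alpha>::'d \<Rightarrow> nat. (\<Sum>i\<in>UNIV. \<alpha> i) \<le> n \<longrightarrow> (\<exists>g. weak_deriv ?U \<alpha> f g \<and>
        (AE y in lborel. y \<in> ?U \<longrightarrow> \<bar>g y\<bar> \<le> 1))"
      using f(1) unfolding sobolev_ball_def by blast
    from spec[OF this, of "count (mset ds)"] show ?thesis
      using n that unfolding sum_count_mset by blast
  qed
  have "test_fun ?U ?\<phi>" by (rule test_fun_reflected_bump[of \<beta>, OF \<beta>(1,2) x])
  moreover have "realises ds (count (mset ds))" by (simp add: realises_def)
  ultimately have gi: "set_integrable lborel ?U (\<lambda>y. g y * ?\<phi> y)"
    and ge: "(LINT y:?U|lborel. f y * Dl ds ?\<phi> y) = (- 1) ^ length ds * (LINT y:?U|lborel. g y * ?\<phi> y)"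
    using g(1) unfolding weak_deriv_def sum_count_mset by blast+
  have ch: "continuous_on (cbox 0 One) ?h" "continuous_on (cbox 0 One) ?\<phi>"
    by (intro continuous_intros continuous_on_bump_prod[of \<beta>, OF \<beta>(1)] f(2))+
  have "(LINT y:?U|lborel. f y * Dl ds ?\<phi> y) = (LINT y:?U|lborel. (- 1) ^ length ds * ?h y)"
    unfolding Dl_reflected_bump(1)[of \<beta>, OF \<beta>(1)] by (simp add: mult_ac)
  also have "\<dots> = (- 1) ^ length ds * (LINT y:?U|lborel. ?h y)" by simp
  finally have "\<bar>LINT y:?U|lborel. ?h y\<bar> = \<bar>LINT y:?U|lborel. g y * ?\<phi> y\<bar>"
    using ge by (simp add: abs_mult)
  also have "\<dots> \<le> (LINT y:?U|lborel. ?\<phi> y)"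
  proof -
    have nn: "0 \<le> ?\<phi> y" for y unfolding bump_prod_def by (intro prod_nonneg) (simp add: \<beta>(3))
    have "norm (LINT y:?U|lborel. g y * ?\<phi> y) \<le> (LINT y|lborel. norm (indicator ?U y *\<^sub>R (g y * ?\<phi> y)))"
      unfolding set_lebesgue_integral_def by (rule integral_norm_bound)
    also have "\<dots> \<le> (LINT y|lborel. indicator ?U y *\<^sub>R ?\<phi> y)"
    proof (rule integral_mono_AE)
      show "integrable lborel (\<lambda>y. norm (indicator ?U y *\<^sub>R (g y * ?\<phi> y)))"
        using gi unfolding set_integrable_def by (rule integrable_norm)
      show "integrable lborel (\<lambda>y. indicator ?U y *\<^sub>R ?\<phi> y)"
        using set_integrable_box_continuous[OF ch(2)] unfolding set_integrable_def .
      show "AE y in lborel. norm (indicator ?U y *\<^sub>R (g y * ?\<phi> y)) \<le> indicator ?U y *\<^sub>R ?\<phi> y"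
        using g(2) by eventually_elim (use nn in \<open>auto simp: indicator_def abs_mult mult_left_le_one_le\<close>)
    qed
    finally show ?thesis by (simp add: set_lebesgue_integral_def)
  qed
  finally show ?thesis unfolding LINT[OF ch(1)] LINT[OF ch(2)] .
qed

lemma bump_prod_zero:
  assumes "\<And>k t. \<not> (0 < t \<and> t < \<delta>) \<Longrightarrow> \<beta> k t = 0" "\<not> (0 < z $ i \<and> z $ i < \<delta>)"
  shows "bump_prod \<beta> ds z = 0"
  unfolding bump_prod_def using assms by (intro prod_zero bexI[of _ i]) auto

lemma integral_bump_prod_pos:
  assumes \<beta>: "\<And>k t. (\<beta> k has_real_derivative \<beta> (Suc k) t) (at t)"
    "\<And>k t. \<not> (0 < t \<and> t < \<delta>) \<Longrightarrow> \<beta> k t = 0" "\<And>t. 0 < t \<Longrightarrow> t < \<delta> \<Longrightarrow> 0 < \<beta> 0 t"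
    and \<delta>: "\<delta> > 0"
  shows "0 < integral (cbox 0 (\<chi> i. \<delta>)) (bump_prod \<beta> [] :: real ^ 'd::finite \<Rightarrow> real)"
proof (rule ccontr)
  let ?K = "cbox 0 (\<chi> i. \<delta>) :: (real ^ 'd) set" and ?h = "bump_prod \<beta> [] :: real ^ 'd \<Rightarrow> real"
  assume c: "\<not> 0 < integral ?K ?h"
  have nn: "0 \<le> \<beta> 0 t" for t using \<beta>(2,3)[of t] by (metis order.refl less_imp_le)
  then have "0 \<le> ?h z" for z by (auto simp: bump_prod_def intro!: prod_nonneg)
  moreover have ch: "continuous_on ?K ?h"
    by (rule continuous_on_bump_prod[of \<beta>, OF \<beta>(1) continuous_on_id])
  then have "?h integrable_on ?K" by (rule integrable_continuous)
  ultimately have "(?h has_integral 0) ?K"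
    using c integral_nonneg[of ?h ?K] by (metis has_integral_integral less_eq_real_def)
  moreover have "(\<chi> i. \<delta> / 2) \<in> box 0 (\<chi> i. \<delta>)" using \<delta> by (simp add: mem_box_cart)
  ultimately have "?h (\<chi> i. \<delta> / 2) = 0"
    using \<open>\<And>z. 0 \<le> ?h z\<close> ch by (intro has_integral_0_cbox_imp_0[of 0 "\<chi> i. \<delta>" ?h]) (auto simp: box_subset_cbox[THEN subsetD])
  moreover have "0 < ?h (\<chi> i. \<delta> / 2)"
    using \<beta>(3)[of "\<delta> / 2"] \<delta> unfolding bump_prod_def by (intro prod_pos) simp
  ultimately show False by simp
qed

text \<open>The normalising constant is the same for all these x, because the reflected support
  stays inside the unit cube.\<close>

lemma integral_reflected_bump_prod:
  fixes x :: "real ^ 'd::finite"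
  assumes \<beta>: "\<And>k t. (\<beta> k has_real_derivative \<beta> (Suc k) t) (at t)"
    "\<And>k t. \<not> (0 < t \<and> t < \<delta>) \<Longrightarrow> \<beta> k t = 0"
    and x: "\<And>i. \<delta> < x $ i \<and> x $ i < 1"
  shows "integral (cbox 0 One) (\<lambda>y. bump_prod \<beta> [] (x - y)) = integral (cbox 0 (\<chi> i. \<delta>)) (bump_prod \<beta> [] :: real ^ 'd \<Rightarrow> real)"
proof -
  let ?K = "cbox 0 (\<chi> i. \<delta>) :: (real ^ 'd) set" and ?h = "bump_prod \<beta> [] :: real ^ 'd \<Rightarrow> real"
  have "continuous_on ?K ?h"
    by (rule continuous_on_bump_prod[of \<beta>, OF \<beta>(1) continuous_on_id])
  then have "(?h has_integral integral ?K ?h) ?K" using integrable_continuous by blast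
  from has_integral_affinity[OF this, of "- 1" x]
  have i: "((\<lambda>y. ?h (x - y)) has_integral integral ?K ?h) ((\<lambda>y. x - y) ` ?K)" by simp
  have "((\<lambda>y. ?h (x - y)) has_integral integral ?K ?h) (cbox 0 One)"
  proof (rule has_integral_on_superset[OF i])
    fix y assume "y \<notin> (\<lambda>y. x - y) ` ?K"
    then have "x - y \<notin> ?K" by (metis diff_diff_eq2 add_diff_cancel_left' imageI)
    then obtain i where "\<not> (0 \<le> (x - y) $ i \<and> (x - y) $ i \<le> \<delta>)" by (auto simp: mem_box_cart)
    then have "\<not> (0 < (x - y) $ i \<and> (x - y) $ i < \<delta>)" by linarith
    then show "?h (x - y) = 0" using \<beta>(2) by (intro bump_prod_zero[where \<delta> = \<delta> and i = i]) blast+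
  next
    show "(\<lambda>y. x - y) ` ?K \<subseteq> cbox 0 One"
    proof clarify
      fix y assume "y \<in> ?K"
      then have "0 \<le> y $ i \<and> y $ i \<le> \<delta>" for i by (simp add: mem_box_cart)
      then have "0 \<le> (x - y) $ i \<and> (x - y) $ i \<le> 1" for i using x[of i] by (smt (verit) vector_minus_component)
      then show "x - y \<in> cbox 0 One" by (simp add: mem_box_cart One_vec_nth del: sum_component vector_minus_component)
    qed
  qed
  then show ?thesis by (rule integral_unique)
qed

lemma mem_unit_cube_iff: "x \<in> cbox 0 (One :: real ^ 'd::finite) \<longleftrightarrow> (\<forall>i. 0 \<le> x $ i \<and> x $ i \<le> 1)"
  by (simp add: mem_box_cart One_vec_nth del: sum_component)

text \<open>\<open>G ds\<close> stands for the derivative along \<open>ds\<close> of the smoothed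
  function. Handing over the whole family with its derivative rule makes higher derivatives
  available without iterating an operator on functions.\<close>

lemma sobolev_smoothing:
  fixes f :: "real ^ 'd::finite \<Rightarrow> real"
  assumes f: "f \<in> sobolev_ball n" "continuous_on (cbox 0 One) f" and \<eta>: "\<eta> > 0"
  obtains G :: "'d list \<Rightarrow> real ^ 'd \<Rightarrow> real" where
    "\<And>x. x \<in> cbox 0 One \<Longrightarrow> \<bar>G [] x - f x\<bar> \<le> \<eta>"
    "\<And>ds x. length ds \<le> n \<Longrightarrow> x \<in> cbox 0 One \<Longrightarrow> \<bar>G ds x\<bar> \<le> 1"
    "\<And>ds a v t. ((\<lambda>t. G ds (a + t *\<^sub>R v)) has_real_derivative
        (\<Sum>i\<in>UNIV. v $ i * G (i # ds) (a + t *\<^sub>R v))) (at t)"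
proof -
  let ?Q = "cbox 0 One :: (real ^ 'd) set"
  have "uniformly_continuous_on ?Q f"
    by (rule compact_uniformly_continuous[OF f(2) compact_cbox])
  then obtain \<rho> where \<rho>: "\<rho> > 0" "\<And>x y. x \<in> ?Q \<Longrightarrow> y \<in> ?Q \<Longrightarrow> dist y x < \<rho> \<Longrightarrow> \<bar>f y - f x\<bar> < \<eta>"
    using \<eta> unfolding uniformly_continuous_on_def dist_real_def by metis
  \<comment> \<open>The kernel reaches points that differ from x by at most 2 \<delta> + \<delta> in
    each coordinate; d times this must stay below the radius of uniform continuity. The cap 1/4
    keeps 1 - 3 \<delta> positive.\<close>
  define \<delta> where "\<delta> = min (1 / 4) (\<rho> / (4 * CARD('d)))"
  have \<delta>: "0 < \<delta>" "\<delta> \<le> 1 / 4" "3 * \<delta> * CARD('d) < \<rho>"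
  proof -
    show "0 < \<delta>" "\<delta> \<le> 1 / 4" using \<rho>(1) by (auto simp: \<delta>_def)
    have "\<delta> \<le> \<rho> / (4 * CARD('d))" by (simp add: \<delta>_def)
    then have "4 * \<delta> * CARD('d) \<le> \<rho>" by (simp add: field_simps)
    moreover have "0 < \<delta> * CARD('d)" using \<open>0 < \<delta>\<close> by simp
    ultimately show "3 * \<delta> * CARD('d) < \<rho>" by linarith
  qed
  obtain \<beta> where \<beta>: "\<And>k t. (\<beta> k has_real_derivative \<beta> (Suc k) t) (at t)"
    "\<And>k t. \<not> (0 < t \<and> t < \<delta>) \<Longrightarrow> \<beta> k t = 0" "\<And>t. 0 < t \<Longrightarrow> t < \<delta> \<Longrightarrow> 0 < \<beta> 0 t"
    using bump_exists[OF \<delta>(1)] by blast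
  have \<beta>0: "0 \<le> \<beta> 0 t" for t using \<beta>(2,3)[of t] by (metis order.refl less_imp_le)
  define J where "J = integral (cbox 0 (\<chi> i. \<delta>)) (bump_prod \<beta> [] :: real ^ 'd \<Rightarrow> real)"
  have J: "J > 0" unfolding J_def by (rule integral_bump_prod_pos[of \<beta>, OF \<beta> \<delta>(1)])
  \<comment> \<open>Maps [0, 1] onto [2 \<delta>, 1 - \<delta>] in each coordinate, where the kernel
    fits into the open cube.\<close>
  define \<tau> where "\<tau> x = (\<chi> i. 2 * \<delta> + (1 - 3 * \<delta>) * x $ i)" for x :: "real ^ 'd"
  have \<tau>: "\<delta> < \<tau> x $ i \<and> \<tau> x $ i < 1" "\<bar>\<tau> x $ i - x $ i\<bar> \<le> 2 * \<delta>" if "x \<in> ?Q" for x i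
  proof -
    have x: "0 \<le> x $ i" "x $ i \<le> 1" using that by (auto simp: mem_unit_cube_iff)
    have "0 \<le> (1 - 3 * \<delta>) * x $ i" "(1 - 3 * \<delta>) * x $ i \<le> 1 - 3 * \<delta>"
      using x \<delta> by (auto intro!: mult_left_le mult_nonneg_nonneg)
    then have "\<delta> < 2 * \<delta> + (1 - 3 * \<delta>) * x $ i" "2 * \<delta> + (1 - 3 * \<delta>) * x $ i < 1"
      using \<delta>(1,2) by linarith+
    then show "\<delta> < \<tau> x $ i \<and> \<tau> x $ i < 1" by (simp add: \<tau>_def)
    have "0 \<le> \<delta> * x $ i" "\<delta> * x $ i \<le> \<delta> * 1"
      using x \<delta> by (auto intro!: mult_left_mono)
    then show "\<bar>\<tau> x $ i - x $ i\<bar> \<le> 2 * \<delta>" unfolding \<tau>_def vec_lambda_beta left_diff_distrib by linarith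
  qed
  define H where "H ds x = integral ?Q (\<lambda>y. f y * bump_prod \<beta> ds (x - y))" for ds x
  have H_DERIV: "((\<lambda>t. H ds (a + t *\<^sub>R v)) has_real_derivative (\<Sum>i\<in>UNIV. v $ i * H (i # ds) (a + t *\<^sub>R v))) (at t)"
    for ds a v t
  proof -
    have "((\<lambda>t. integral ?Q (\<lambda>y. f y * bump_prod \<beta> ds (a + t *\<^sub>R v - y))) has_real_derivative
       integral ?Q (\<lambda>y. f y * (\<Sum>i\<in>UNIV. v $ i * bump_prod \<beta> (i # ds) (a + t *\<^sub>R v - y)))) (at t within UNIV)"
    proof (rule leibniz_rule_field_derivative)
      fix t y
      have "((\<lambda>t. bump_prod \<beta> ds (a + t *\<^sub>R v - y)) has_real_derivative
          (\<Sum>i\<in>UNIV. v $ i * bump_prod \<beta> (i # ds) (a + t *\<^sub>R v - y))) (at t)"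
        by (rule bump_prod_DERIV[of \<beta>, OF \<beta>(1)]) (auto intro!: derivative_eq_intros)
      from DERIV_cmult[OF this, of "f y"]
      show "((\<lambda>t. f y * bump_prod \<beta> ds (a + t *\<^sub>R v - y)) has_real_derivative
          f y * (\<Sum>i\<in>UNIV. v $ i * bump_prod \<beta> (i # ds) (a + t *\<^sub>R v - y))) (at t)" .
      show "(\<lambda>y. f y * bump_prod \<beta> ds (a + t *\<^sub>R v - y)) integrable_on ?Q"
        by (intro integrable_continuous continuous_intros f(2) continuous_on_bump_prod[of \<beta>, OF \<beta>(1)])
    next
      show "continuous_on (UNIV \<times> ?Q) (\<lambda>(t, y). f y * (\<Sum>i\<in>UNIV. v $ i * bump_prod \<beta> (i # ds) (a + t *\<^sub>R v - y)))"
        unfolding split_beta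
        by (intro continuous_intros continuous_on_bump_prod[of \<beta>, OF \<beta>(1)] continuous_on_compose2[OF f(2)]) auto
    qed auto
    moreover have "integral ?Q (\<lambda>y. f y * (\<Sum>i\<in>UNIV. v $ i * bump_prod \<beta> (i # ds) (a + t *\<^sub>R v - y)))
        = (\<Sum>i\<in>UNIV. v $ i * H (i # ds) (a + t *\<^sub>R v))"
    proof -
      have "integral ?Q (\<lambda>y. f y * (\<Sum>i\<in>UNIV. v $ i * bump_prod \<beta> (i # ds) (a + t *\<^sub>R v - y)))
         = integral ?Q (\<lambda>y. \<Sum>i\<in>UNIV. v $ i * (f y * bump_prod \<beta> (i # ds) (a + t *\<^sub>R v - y)))"
        by (simp add: sum_distrib_left mult_ac)
      also have "\<dots> = (\<Sum>i\<in>UNIV. integral ?Q (\<lambda>y. v $ i * (f y * bump_prod \<beta> (i # ds) (a + t *\<^sub>R v - y))))"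
        by (intro integral_sum integrable_continuous continuous_intros f(2) continuous_on_bump_prod[of \<beta>, OF \<beta>(1)]) auto
      finally show ?thesis by (simp add: H_def)
    qed
    ultimately show ?thesis by (simp add: H_def)
  qed
  \<comment> \<open>The chain rule through \<open>\<tau>\<close> gives one factor 1 - 3 \<delta> per
    derivative; being at most 1, it preserves the bound on the derivatives.\<close>
  define G where "G ds x = (1 - 3 * \<delta>) ^ length ds / J * H ds (\<tau> x)" for ds x
  have intJ: "integral ?Q (\<lambda>y. bump_prod \<beta> [] (\<tau> x - y)) = J" if "x \<in> ?Q" for x
    unfolding J_def by (rule integral_reflected_bump_prod[of \<beta>, OF \<beta>(1,2) \<tau>(1)[OF that]])
  show ?thesis
  proof (rule that[of G])
    fix ds a v t
    have e: "\<tau> (a + t *\<^sub>R v) = \<tau> a + t *\<^sub>R ((1 - 3 * \<delta>) *\<^sub>R v)" for t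
      by (simp add: \<tau>_def vec_eq_iff algebra_simps)
    show "((\<lambda>t. G ds (a + t *\<^sub>R v)) has_real_derivative
        (\<Sum>i\<in>UNIV. v $ i * G (i # ds) (a + t *\<^sub>R v))) (at t)"
      unfolding G_def e using DERIV_cmult[OF H_DERIV, of "(1 - 3 * \<delta>) ^ length ds / J" ds "\<tau> a" "(1 - 3 * \<delta>) *\<^sub>R v" t]
      by (simp add: sum_distrib_left mult_ac)
  next
    fix ds :: "'d list" and x assume n: "length ds \<le> n" and x: "x \<in> ?Q"
    have "\<bar>H ds (\<tau> x)\<bar> \<le> J"
      unfolding H_def intJ[OF x, symmetric]
      by (rule weak_deriv_convolution_bound[of f n \<beta>, OF f \<beta>(1,2) \<beta>0 \<tau>(1)[OF x] n])
    moreover have "(1 - 3 * \<delta>) ^ length ds \<le> 1" using \<delta> by (intro power_le_one) auto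
    ultimately have "(1 - 3 * \<delta>) ^ length ds * \<bar>H ds (\<tau> x)\<bar> \<le> 1 * J"
      using \<delta> by (intro mult_mono) auto
    then show "\<bar>G ds x\<bar> \<le> 1" using J \<delta> by (simp add: G_def abs_mult)
  next
    fix x assume x: "x \<in> ?Q"
    let ?\<phi> = "\<lambda>y. bump_prod \<beta> [] (\<tau> x - y)"
    have c: "continuous_on ?Q ?\<phi>"
      by (intro continuous_intros continuous_on_bump_prod[of \<beta>, OF \<beta>(1)])
    have "H [] (\<tau> x) - f x * J = integral ?Q (\<lambda>y. f y * ?\<phi> y) - integral ?Q (\<lambda>y. f x * ?\<phi> y)"
      by (simp add: H_def intJ[OF x])
    also have "\<dots> = integral ?Q (\<lambda>y. f y * ?\<phi> y - f x * ?\<phi> y)"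
      by (rule integral_diff[symmetric]) (intro integrable_continuous continuous_intros f(2) c)+
    also have "norm \<dots> \<le> integral ?Q (\<lambda>y. \<eta> * ?\<phi> y)"
    proof (rule integral_norm_bound_integral)
      fix y assume y: "y \<in> ?Q"
      show "norm (f y * ?\<phi> y - f x * ?\<phi> y) \<le> \<eta> * ?\<phi> y"
      proof (cases "\<forall>i. 0 < (\<tau> x - y) $ i \<and> (\<tau> x - y) $ i < \<delta>")
        case True
        have "\<bar>(y - x) $ i\<bar> \<le> 3 * \<delta>" for i
          using True[rule_format, of i] \<tau>(2)[OF x, of i] by (simp add: abs_le_iff)
        then have "(\<Sum>i\<in>UNIV. \<bar>(y - x) $ i\<bar>) \<le> of_nat CARD('d) * (3 * \<delta>)"
          by (intro sum_bounded_above) auto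
        then have "dist y x < \<rho>" using norm_le_l1_cart[of "y - x"] \<delta>(3) by (simp add: dist_norm mult_ac)
        then have "\<bar>f y - f x\<bar> \<le> \<eta>" using \<rho>(2)[OF x y] by simp
        moreover have "0 \<le> ?\<phi> y" unfolding bump_prod_def by (intro prod_nonneg) (simp add: \<beta>0)
        moreover have "f y * ?\<phi> y - f x * ?\<phi> y = (f y - f x) * ?\<phi> y" by (simp add: left_diff_distrib)
        ultimately show ?thesis by (simp add: abs_mult mult_right_mono)
      next
        case False
        then obtain i where "\<not> (0 < (\<tau> x - y) $ i \<and> (\<tau> x - y) $ i < \<delta>)" by blast
        then have "?\<phi> y = 0" using \<beta>(2) by (intro bump_prod_zero[where \<delta> = \<delta> and i = i]) blast+
        then show ?thesis by simp
      qed
    qed (intro integrable_continuous continuous_intros f(2) c)+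
    also have "\<dots> = \<eta> * J" by (simp add: intJ[OF x])
    finally have "\<bar>H [] (\<tau> x) - f x * J\<bar> \<le> \<eta> * J" by simp
    moreover have "G [] x - f x = (H [] (\<tau> x) - f x * J) / J" using J by (simp add: G_def field_simps)
    ultimately show "\<bar>G [] x - f x\<bar> \<le> \<eta>" using J by (simp add: abs_divide pos_divide_le_eq)
  qed
qed

section \<open>Taylor's formula over lists of directions\<close>

lemma sum_lists_Suc:
  fixes g :: "'d::finite list \<Rightarrow> real"
  shows "(\<Sum>ds | length ds = Suc k. g ds) = (\<Sum>ds | length ds = k. \<Sum>i\<in>UNIV. g (i # ds))"
proof -
  have fin: "finite {ds :: 'd list. length ds = k}"
    using finite_lists_length_eq[of "UNIV :: 'd set" k] by simp
  have "(\<Sum>ds | length ds = Suc k. g ds) = (\<Sum>(ds, i)\<in>{ds. length ds = k} \<times> UNIV. g (i # ds))"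
    by (rule sum.reindex_bij_witness[of _ "\<lambda>(ds, i). i # ds" "\<lambda>ds. (tl ds, hd ds)"]) (auto simp: length_Suc_conv)
  then show ?thesis using fin by (simp add: sum.cartesian_product)
qed

lemma abs_prod_list_le_power:
  fixes g :: "'a \<Rightarrow> real"
  assumes "\<And>i. i \<in> set ds \<Longrightarrow> \<bar>g i\<bar> \<le> r"
  shows "\<bar>\<Prod>i\<leftarrow>ds. g i\<bar> \<le> r ^ length ds"
  using assms
proof (induction ds)
  case (Cons i ds)
  moreover have "0 \<le> r" using Cons.prems[of i] by force
  ultimately show ?case by (simp add: abs_mult mult_mono)
qed simp

text \<open>This is the one-dimensional formula along the segment from a to x. Ordered lists of
  directions count every multi-index with its multinomial coefficient, so the weight is 1/k!
  throughout. The remainder runs over d^n lists, each contributing at most r^n.\<close>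

lemma taylor_lists:
  fixes G :: "'d::finite list \<Rightarrow> real ^ 'd \<Rightarrow> real" and r :: real
  assumes D: "\<And>ds a v t. ((\<lambda>t. G ds (a + t *\<^sub>R v)) has_real_derivative
        (\<Sum>i\<in>UNIV. v $ i * G (i # ds) (a + t *\<^sub>R v))) (at t)"
    and b: "\<And>ds x. length ds = n \<Longrightarrow> x \<in> cbox 0 One \<Longrightarrow> \<bar>G ds x\<bar> \<le> 1"
    and ax: "a \<in> cbox 0 One" "x \<in> cbox 0 One" and r: "\<And>i. \<bar>x $ i - a $ i\<bar> \<le> r"
  shows "\<bar>G [] x - (\<Sum>k<n. \<Sum>ds | length ds = k. G ds a / fact k * (\<Prod>i\<leftarrow>ds. x $ i - a $ i))\<bar> \<le> (CARD('d) * r) ^ n"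
proof -
  define v where "v = x - a"
  define \<phi> where "\<phi> k t = (\<Sum>ds | length ds = k. (\<Prod>i\<leftarrow>ds. v $ i) * G ds (a + t *\<^sub>R v))" for k t
  have "(\<phi> k has_real_derivative \<phi> (Suc k) t) (at t)" for k t
  proof -
    have "(\<phi> k has_real_derivative (\<Sum>ds | length ds = k. (\<Prod>i\<leftarrow>ds. v $ i) * (\<Sum>i\<in>UNIV. v $ i * G (i # ds) (a + t *\<^sub>R v)))) (at t)"
      unfolding \<phi>_def by (intro DERIV_sum DERIV_cmult D)
    then show ?thesis unfolding \<phi>_def sum_lists_Suc by (simp add: sum_distrib_left mult_ac)
  qed
  then obtain t where t: "0 < t" "t \<le> 1" "\<phi> 0 1 = (\<Sum>k<n. \<phi> k 0 / fact k * 1 ^ k) + \<phi> n t / fact n * 1 ^ n"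
    using Maclaurin2[of 1 \<phi> "\<phi> 0" n] by auto
  have r0: "0 \<le> r" using r[of undefined] by linarith
  have "a + t *\<^sub>R v \<in> cbox 0 One"
  proof -
    have "a + t *\<^sub>R v = (1 - t) *\<^sub>R a + t *\<^sub>R x" by (simp add: v_def algebra_simps)
    then show ?thesis using convexD_alt[OF convex_box(1) ax, of t] t by simp
  qed
  have "\<bar>\<phi> n t\<bar> \<le> (\<Sum>ds | length ds = n. \<bar>(\<Prod>i\<leftarrow>ds. v $ i) * G ds (a + t *\<^sub>R v)\<bar>)"
    unfolding \<phi>_def by (rule sum_abs)
  also have "\<dots> \<le> real (card {ds :: 'd list. length ds = n}) * r ^ n"
  proof (rule sum_bounded_above)
    fix ds :: "'d list" assume ds: "ds \<in> {ds. length ds = n}"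
    have "\<bar>\<Prod>i\<leftarrow>ds. v $ i\<bar> \<le> r ^ length ds"
      using r by (intro abs_prod_list_le_power) (simp add: v_def)
    then have "\<bar>\<Prod>i\<leftarrow>ds. v $ i\<bar> * \<bar>G ds (a + t *\<^sub>R v)\<bar> \<le> r ^ n * 1"
      using ds b \<open>a + t *\<^sub>R v \<in> cbox 0 One\<close> r0 by (intro mult_mono) auto
    then show "\<bar>(\<Prod>i\<leftarrow>ds. v $ i) * G ds (a + t *\<^sub>R v)\<bar> \<le> r ^ n" by (simp add: abs_mult)
  qed
  also have "\<dots> = (CARD('d) * r) ^ n"
    using card_lists_length_eq[of "UNIV :: 'd set" n] by (simp add: power_mult_distrib)
  finally have "\<bar>\<phi> n t\<bar> \<le> (CARD('d) * r) ^ n" .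
  moreover have "\<bar>\<phi> n t / fact n\<bar> \<le> \<bar>\<phi> n t\<bar> / 1"
    unfolding abs_divide by (intro divide_left_mono) (auto simp: fact_ge_1 fact_ge_1[of n, where 'a = real])
  moreover have "\<phi> 0 1 = G [] x" by (simp add: \<phi>_def v_def)
  moreover have e: "(\<Sum>k<n. \<phi> k 0 / fact k * 1 ^ k) =
      (\<Sum>k<n. \<Sum>ds | length ds = k. G ds a / fact k * (\<Prod>i\<leftarrow>ds. x $ i - a $ i))"
    by (simp add: \<phi>_def v_def sum_divide_distrib mult_ac)
  ultimately show ?thesis using t(3) unfolding e power_one mult_1_right by linarith
qed

section \<open>Local approximation and the network family\<close>

definition hat :: "real \<Rightarrow> real" where
  "hat y = max 0 (1 - \<bar>y\<bar>)"

lemma hat_bounds: "0 \<le> hat y" "hat y \<le> 1"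
  by (auto simp: hat_def)

lemma sum_hat:
  assumes "0 \<le> y" "y \<le> real N"
  shows "(\<Sum>k\<le>N. hat (y - real k)) = 1"
proof -
  \<comment> \<open>A closed form valid for every N drives the induction: as a function of y the
    partial sum is 1 up to N and falls linearly to 0 at N + 1.\<close>
  have "(\<Sum>k\<le>N. hat (y - real k)) = min 1 (max 0 (real N + 1 - y))"
    using assms(1) by (induction N) (auto simp: hat_def min_def max_def abs_if)
  then show ?thesis using assms(2) by simp
qed

definition grid :: "nat \<Rightarrow> ('d::finite \<Rightarrow> nat) set" where
  "grid p = PiE UNIV (\<lambda>_. {..2 ^ p})"

definition hat_prod :: "nat \<Rightarrow> ('d::finite \<Rightarrow> nat) \<Rightarrow> real ^ 'd \<Rightarrow> real" where
  "hat_prod p m x = (\<Prod>i\<in>UNIV. hat (2 ^ p * x $ i - real (m i)))"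

lemma mem_grid_iff: "m \<in> grid p \<longleftrightarrow> (\<forall>i. m i \<le> 2 ^ p)"
  by (auto simp: grid_def PiE_def extensional_def)

lemma finite_grid: "finite (grid p :: ('d::finite \<Rightarrow> nat) set)"
  unfolding grid_def by (rule finite_PiE) auto

lemma card_grid: "card (grid p :: ('d::finite \<Rightarrow> nat) set) = (2 ^ p + 1) ^ CARD('d)"
  unfolding grid_def by (simp add: card_PiE)

lemma hat_prod_bounds: "0 \<le> hat_prod p m x" "hat_prod p m x \<le> 1"
  by (auto simp: hat_prod_def hat_bounds intro!: prod_nonneg prod_le_1)

lemma sum_hat_prod:
  fixes x :: "real ^ 'd::finite"
  assumes "x \<in> cbox 0 One"
  shows "(\<Sum>m\<in>grid p. hat_prod p m x) = 1"
proof -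
  have "(\<Sum>k\<le>2 ^ p. hat (2 ^ p * x $ i - real k)) = 1" for i
  proof -
    have "0 \<le> x $ i" "x $ i \<le> 1" using assms by (auto simp: mem_unit_cube_iff)
    then have "0 \<le> 2 ^ p * x $ i" "2 ^ p * x $ i \<le> real (2 ^ p)" by (auto intro: mult_left_le)
    then show ?thesis by (rule sum_hat)
  qed
  then have "(\<Prod>i\<in>UNIV. \<Sum>k\<in>{..2 ^ p}. hat (2 ^ p * x $ i - real k)) = 1" by simp
  then show ?thesis unfolding hat_prod_def grid_def by (subst (asm) prod_sum_PiE) auto
qed

text \<open>The Taylor centre of cell \<open>m\<close> has coordinates \<open>(m i - 1) / 2^p\<close> with truncated subtraction: it lies in the unit cube and
  below every point of the support of the hat product, so there the ReLU in the factors is inactive.\<close>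

definition local_term :: "nat \<Rightarrow> ('d::finite \<Rightarrow> nat) \<Rightarrow> 'd list \<Rightarrow> real ^ 'd \<Rightarrow> real" where
  "local_term p m ds x = hat_prod p m x * (\<Prod>i\<leftarrow>ds. max 0 (x $ i - real (m i - 1) / 2 ^ p))"

text \<open>Since the hat products sum to 1, it suffices to compare the smoothed function with each
  Taylor polynomial on the support of its hat product, which lies within 2/2^p of the centre in each
  coordinate. The smoothing tolerance 2^(-pn) has the order of the Taylor error.\<close>

lemma sobolev_local_approx:
  fixes f :: "real ^ 'd::finite \<Rightarrow> real"
  assumes f: "f \<in> sobolev_ball n" "continuous_on (cbox 0 One) f"
  obtains c :: "('d \<Rightarrow> nat) \<Rightarrow> 'd list \<Rightarrow> real" where
    "\<And>m ds. \<bar>c m ds\<bar> \<le> 1"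
    "\<And>x. x \<in> cbox 0 One \<Longrightarrow>
       \<bar>f x - (\<Sum>m\<in>grid p. \<Sum>ds | length ds < n. c m ds * local_term p m ds x)\<bar>
         \<le> (1 + (2 * CARD('d)) ^ n) / 2 ^ (p * n)"
proof -
  let ?Q = "cbox 0 One :: (real ^ 'd) set"
  define \<eta> :: real where "\<eta> = 1 / 2 ^ (p * n)"
  obtain G where G: "\<And>x. x \<in> ?Q \<Longrightarrow> \<bar>G [] x - f x\<bar> \<le> \<eta>"
    "\<And>ds x. length ds \<le> n \<Longrightarrow> x \<in> ?Q \<Longrightarrow> \<bar>G ds x\<bar> \<le> 1"
    "\<And>ds a v t. ((\<lambda>t. G ds (a + t *\<^sub>R v)) has_real_derivative
        (\<Sum>i\<in>UNIV. v $ i * G (i # ds) (a + t *\<^sub>R v))) (at t)"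
    using sobolev_smoothing[OF f, of \<eta>] by (auto simp: \<eta>_def)
  define a where "a m = (\<chi> i. real (m i - 1) / 2 ^ p)" for m :: "'d \<Rightarrow> nat"
  have a: "a m \<in> ?Q" if "m \<in> grid p" for m
  proof -
    have "real (m i - 1) \<le> 2 ^ p" for i
    proof -
      have "m i - 1 \<le> 2 ^ p" using that[unfolded mem_grid_iff, rule_format, of i] by linarith
      then show ?thesis by (metis of_nat_le_iff of_nat_numeral of_nat_power)
    qed
    then show ?thesis by (simp add: mem_unit_cube_iff a_def)
  qed
  \<comment> \<open>Zero off the index set, so that the bound by 1 holds without side
    conditions.\<close>
  define c where "c m ds = (if m \<in> grid p \<and> length ds < n then G ds (a m) / fact (length ds) else 0)" for m ds
  define P where "P m x = (\<Sum>k<n. \<Sum>ds | length ds = k. G ds (a m) / fact k * (\<Prod>i\<leftarrow>ds. x $ i - a m $ i))" for m x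
  have local: "\<bar>hat_prod p m x * G [] x - (\<Sum>ds | length ds < n. c m ds * local_term p m ds x)\<bar>
      \<le> hat_prod p m x * ((2 * CARD('d)) ^ n / 2 ^ (p * n))"
    if x: "x \<in> ?Q" and m: "m \<in> grid p" for x m
  proof (cases "hat_prod p m x = 0")
    case True
    then show ?thesis by (simp add: local_term_def)
  next
    case False
    have near: "0 \<le> x $ i - a m $ i \<and> x $ i - a m $ i \<le> 2 / 2 ^ p" for i
    proof -
      have "hat (2 ^ p * x $ i - real (m i)) \<noteq> 0" using False by (auto simp: hat_prod_def)
      then have h: "\<bar>2 ^ p * x $ i - real (m i)\<bar> < 1" by (auto simp: hat_def max_def split: if_splits)
      have "0 \<le> 2 ^ p * x $ i" using x by (simp add: mem_unit_cube_iff)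
      \<comment> \<open>For \<open>m i = 0\<close> the centre has coordinate 0 and the lower bound
        comes from x lying in the cube; otherwise it comes from the hat.\<close>
      with h have "0 \<le> 2 ^ p * x $ i - real (m i - 1)" "2 ^ p * x $ i - real (m i - 1) \<le> 2"
        by (cases "m i"; force)+
      moreover have "x $ i - a m $ i = (2 ^ p * x $ i - real (m i - 1)) / 2 ^ p"
        by (simp add: a_def diff_divide_distrib)
      ultimately show ?thesis by (simp add: divide_right_mono)
    qed
    have "\<bar>G [] x - P m x\<bar> \<le> (CARD('d) * (2 / 2 ^ p)) ^ n"
      unfolding P_def by (rule taylor_lists[OF G(3)]) (use G(2) a[OF m] x near in auto)
    also have "\<dots> = (2 * CARD('d)) ^ n / 2 ^ (p * n)"
      unfolding power_mult by (simp add: power_divide power_mult_distrib mult.commute)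
    finally have "\<bar>G [] x - P m x\<bar> \<le> (2 * CARD('d)) ^ n / 2 ^ (p * n)" by simp
    moreover have "(\<Sum>ds | length ds < n. c m ds * local_term p m ds x) = hat_prod p m x * P m x"
    proof -
      have "(\<Sum>ds | length ds < n. c m ds * local_term p m ds x)
          = (\<Sum>ds\<in>(\<Union>k<n. {ds. length ds = k}). c m ds * local_term p m ds x)"
        by (rule sum.cong) auto
      also have "\<dots> = (\<Sum>k<n. \<Sum>ds | length ds = k. c m ds * local_term p m ds x)"
        using finite_lists_length_eq[of "UNIV :: 'd set"] by (subst sum.UNION_disjoint) auto
      also have "\<dots> = (\<Sum>k<n. \<Sum>ds | length ds = k. hat_prod p m x * (G ds (a m) / fact k * (\<Prod>i\<leftarrow>ds. x $ i - a m $ i)))"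
      proof (intro sum.cong refl)
        fix k and ds :: "'d list" assume "k \<in> {..<n}" "ds \<in> {ds. length ds = k}"
        moreover have "(\<Prod>i\<leftarrow>ds. max 0 (x $ i - real (m i - 1) / 2 ^ p)) = (\<Prod>i\<leftarrow>ds. x $ i - a m $ i)"
          using near by (intro arg_cong[of _ _ prod_list] map_cong) (auto simp: a_def max_def)
        ultimately show "c m ds * local_term p m ds x = hat_prod p m x * (G ds (a m) / fact k * (\<Prod>i\<leftarrow>ds. x $ i - a m $ i))"
          using m by (simp add: c_def local_term_def)
      qed
      finally show ?thesis by (simp add: P_def sum_distrib_left)
    qed
    then have "hat_prod p m x * G [] x - (\<Sum>ds | length ds < n. c m ds * local_term p m ds x)
        = hat_prod p m x * (G [] x - P m x)" by (simp add: right_diff_distrib)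
    ultimately show ?thesis
      using hat_prod_bounds(1)[of p m x] by (simp only: abs_mult abs_of_nonneg mult_left_mono)
  qed
  show ?thesis
  proof (rule that[of c])
    fix m ds
    show "\<bar>c m ds\<bar> \<le> 1"
    proof (cases "m \<in> grid p \<and> length ds < n")
      case True
      then have "\<bar>G ds (a m)\<bar> / fact (length ds) \<le> 1 / 1"
        using G(2)[of ds "a m"] a by (intro frac_le) (auto simp: fact_ge_1)
      then show ?thesis using True by (simp add: c_def)
    qed (auto simp: c_def)
  next
    fix x assume x: "x \<in> ?Q"
    have "\<bar>G [] x - (\<Sum>m\<in>grid p. \<Sum>ds | length ds < n. c m ds * local_term p m ds x)\<bar>
        = \<bar>\<Sum>m\<in>grid p. hat_prod p m x * G [] x - (\<Sum>ds | length ds < n. c m ds * local_term p m ds x)\<bar>"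
      by (simp add: sum_subtractf sum_distrib_right[symmetric] sum_hat_prod[OF x])
    also have "\<dots> \<le> (\<Sum>m\<in>grid p. hat_prod p m x * ((2 * CARD('d)) ^ n / 2 ^ (p * n)))"
      by (rule order_trans[OF sum_abs sum_mono[OF local[OF x]]])
    also have "\<dots> = (2 * CARD('d)) ^ n / 2 ^ (p * n)"
      unfolding sum_distrib_right[symmetric] sum_hat_prod[OF x] by simp
    finally show "\<bar>f x - (\<Sum>m\<in>grid p. \<Sum>ds | length ds < n. c m ds * local_term p m ds x)\<bar>
         \<le> (1 + (2 * CARD('d)) ^ n) / 2 ^ (p * n)"
      using G(1)[OF x] by (simp add: \<eta>_def add_divide_distrib)
  qed
qed

section \<open>Networks for a single local term\<close>

definition coord_index :: "'d::finite \<Rightarrow> nat" where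
  "coord_index = inv_into {..<CARD('d)} input_enum"

lemma input_enum_bij: "bij_betw input_enum {..<CARD('d)} (UNIV :: 'd::finite set)"
proof -
  have "\<exists>h. bij_betw h {..<CARD('d)} (UNIV :: 'd set)"
    using ex_bij_betw_nat_finite[of "UNIV :: 'd set"] by (simp add: atLeast0LessThan)
  then show ?thesis unfolding input_enum_def by (rule someI_ex)
qed

lemma coord_index: "coord_index (i :: 'd::finite) < CARD('d)" "coords x ! coord_index i = x $ i"
proof -
  have "i \<in> input_enum ` {..<CARD('d)}" using input_enum_bij[where 'd = 'd] by (simp add: bij_betw_def)
  then have "coord_index i \<in> {..<CARD('d)}" "input_enum (coord_index i) = i"
    unfolding coord_index_def by (rule inv_into_into, rule f_inv_into_f)
  then show "coord_index i < CARD('d)" "coords x ! coord_index i = x $ i"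
    by (auto simp: coords_def)
qed

definition term_factors :: "nat \<Rightarrow> ('d::finite \<Rightarrow> nat) \<Rightarrow> 'd list \<Rightarrow> (real list \<Rightarrow> real) list" where
  "term_factors p m ds =
     map (\<lambda>j xs. hat (2 ^ p * xs ! j - real (m (input_enum j)))) [0..<CARD('d)] @
     map (\<lambda>i xs. max 0 (xs ! coord_index i - real (m i - 1) / 2 ^ p)) ds"

lemma length_term_factors: "length (term_factors p m (ds :: 'd::finite list)) = CARD('d) + length ds"
  by (simp add: term_factors_def)

lemma term_factors_bounds:
  fixes x :: "real ^ 'd::finite" and ds :: "'d list"
  assumes "x \<in> cbox 0 One" "g \<in> set (term_factors p m ds)"
  shows "0 \<le> g (coords x) \<and> g (coords x) \<le> 1"
proof -
  have "max 0 (x $ i - real k / 2 ^ p) \<le> 1" for i k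
    using assms(1) by (simp add: mem_unit_cube_iff add_increasing2 diff_le_eq)
  then show ?thesis using assms(2) by (auto simp: term_factors_def hat_bounds coord_index(2))
qed

lemma prod_term_factors: "(\<Prod>g\<leftarrow>term_factors p m ds. g (coords x)) = local_term p m ds x"
proof -
  have "(\<Prod>j\<leftarrow>[0..<CARD('a)]. hat (2 ^ p * coords x ! j - real (m (input_enum j))))
      = (\<Prod>j\<in>{..<CARD('a)}. hat (2 ^ p * x $ input_enum j - real (m (input_enum j))))"
    by (subst prod.distinct_set_conv_list[symmetric]) (auto simp: coords_def atLeast0LessThan intro!: prod.cong)
  also have "\<dots> = hat_prod p m x"
    unfolding hat_prod_def by (rule prod.reindex_bij_betw[OF input_enum_bij])
  finally show ?thesis
    by (simp add: term_factors_def local_term_def o_def coord_index(2))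
qed

text \<open>The product starts with the digits of the coefficient. One number \<open>T\<close>
  counts both digits and squaring steps, as both errors are exponentially small in it.\<close>

definition term_net_val :: "nat \<Rightarrow> nat \<Rightarrow> ('d::finite \<Rightarrow> nat) \<Rightarrow> 'd list \<Rightarrow> (nat \<Rightarrow> bool) \<Rightarrow> real list \<Rightarrow> real" where
  "term_net_val p T m ds b xs =
     foldl (mult_approx T) (bits_val b T) (map (\<lambda>g. g xs) (term_factors p m ds))"

lemma term_net_val_approx:
  fixes ds :: "'d::finite list"
  assumes "x \<in> cbox 0 One"
  shows "\<bar>term_net_val p T m ds b (coords x) - bits_val b T * local_term p m ds x\<bar>
      \<le> (CARD('d) + length ds) / 4 ^ T"
  using mult_list_bounds[of "bits_val b T" "map (\<lambda>g. g (coords x)) (term_factors p m ds)" T]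
    bits_val_bounds[of b T] term_factors_bounds[OF assms]
  by (auto simp: term_net_val_def length_term_factors prod_term_factors o_def)

text \<open>Depth and size bound do not depend on \<open>m\<close> or \<open>ds\<close>, so that all
  terms can run in parallel. The parameter \<open>q\<close> enters through the digits alone; cell
  and directions belong to the topology.\<close>

lemma computes_term_net:
  fixes ds :: "'d::finite list" and T :: nat and b :: "'p \<Rightarrow> nat \<Rightarrow> bool"
  assumes m: "m \<in> grid p" and K: "CARD('d) + length ds \<le> K"
  defines "w \<equiv> 9 * T + 33 * p + 94"
  shows "computes CARD('d) 1 (T + 2 * p + 6 + K * (T + 7))
     (w + K * (w + 4 * (K * (T + 7)) + 54 * T + 102) + 4 * (K * (T + 7)))
     (\<lambda>q xs. [term_net_val p T m ds (b q) xs])"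
proof -
  let ?d = "CARD('d)" and ?D = "T + 2 * p + 6"
  let ?gs = "map (\<lambda>g (_ :: 'p). g) (term_factors p m ds)"
  have m': "m i \<le> 2 ^ p" "m i - 1 \<le> 2 ^ p" for i
    using m[unfolded mem_grid_iff, rule_format, of i] by linarith+
  have "computes ?d 1 ?D (5 * T + 5 + 4 * (?D - (T + 2))) (\<lambda>q xs. [bits_val (b q) T])"
    by (rule computes_pad[OF computes_bits]) (auto simp: bits_val_bounds)
  then have c0: "computes ?d 1 ?D w (\<lambda>q xs. [bits_val (b q) T])"
    by (rule computes_eqI) (auto simp: w_def)
  have "computes ?d 1 ?D w (\<lambda>q xs. [g q xs]) \<and> (\<forall>q xs. 0 \<le> g q xs)" if g: "g \<in> set ?gs" for g
  proof -
    consider j where "j < ?d" "g = (\<lambda>_ xs. max 0 (1 - \<bar>2 ^ p * xs ! j - real (m (input_enum j))\<bar>))"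
      | i where "g = (\<lambda>_ xs. max 0 (xs ! coord_index i - real (m i - 1) / 2 ^ p))"
      using g by (auto simp: term_factors_def hat_def)
    then show ?thesis
    proof cases
      case 1
      have "computes ?d 1 ?D (25 * p + 65 + 4 * (?D - (2 * p + 6))) (\<lambda>q xs. [g q xs])"
        unfolding 1 by (rule computes_pad[OF computes_hat[OF 1(1) m'(1)]]) auto
      then have "computes ?d 1 ?D w (\<lambda>q xs. [g q xs])" by (rule computes_eqI) (auto simp: w_def)
      then show ?thesis using 1(2) by simp
    next
      case 2
      have "computes ?d 1 ?D (9 * p + 47 + 4 * (?D - (p + 5))) (\<lambda>q xs. [g q xs])"
        unfolding 2 by (rule computes_pad[OF computes_relu_shift[OF coord_index(1) m'(2)]]) auto
      then have "computes ?d 1 ?D w (\<lambda>q xs. [g q xs])" by (rule computes_eqI) (auto simp: w_def)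
      then show ?thesis using 2 by simp
    qed
  qed
  note c = computes_mult_list[OF c0 this, where K = K and S = T]
  let ?l = "length ?gs"
  have l: "?l \<le> K" using K by (simp add: length_term_factors)
  have "computes ?d 1 (?D + ?l * (T + 7)) (w + ?l * (w + 4 * (K * (T + 7)) + 54 * T + 102))
     (\<lambda>q xs. [term_net_val p T m ds (b q) xs])"
    using c[OF _ _ l] by (simp add: term_net_val_def o_def)
  \<comment> \<open>Needed for the final padding to the depth of \<open>K\<close> factors; it holds
    on all inputs because \<open>mult_approx\<close> ends with a cut at 0.\<close>
  moreover have nn: "0 \<le> term_net_val p T m ds (b q) xs" for q xs
  proof (cases "term_factors p m ds" rule: rev_cases)
    case Nil then show ?thesis by (simp add: term_net_val_def bits_val_bounds)
  next
    case (snoc gs g) then show ?thesis by (simp add: term_net_val_def mult_approx_def)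
  qed
  moreover have l2: "?l * (T + 7) \<le> K * (T + 7)" using l by (rule mult_right_mono) simp
  ultimately have "computes ?d 1 (?D + K * (T + 7))
      (w + ?l * (w + 4 * (K * (T + 7)) + 54 * T + 102) + 4 * (?D + K * (T + 7) - (?D + ?l * (T + 7))))
     (\<lambda>q xs. [term_net_val p T m ds (b q) xs])"
    by (intro computes_pad) auto
  then show ?thesis
  proof (rule computes_eqI)
    have "?l * (w + 4 * (K * (T + 7)) + 54 * T + 102) \<le> K * (w + 4 * (K * (T + 7)) + 54 * T + 102)"
      using l by (rule mult_right_mono) simp
    then show "w + ?l * (w + 4 * (K * (T + 7)) + 54 * T + 102) + 4 * (?D + K * (T + 7) - (?D + ?l * (T + 7)))
      \<le> w + K * (w + 4 * (K * (T + 7)) + 54 * T + 102) + 4 * (K * (T + 7))"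
      by linarith
  qed auto
qed

lemma abs_local_term_le:
  assumes "x \<in> cbox 0 One"
  shows "\<bar>local_term p m ds x\<bar> \<le> 1"
proof -
  have "\<bar>max 0 (x $ i - real k / 2 ^ p)\<bar> \<le> 1" for i k
    using assms by (simp add: mem_unit_cube_iff add_increasing2 diff_le_eq)
  then have "\<bar>\<Prod>i\<leftarrow>ds. max 0 (x $ i - real (m i - 1) / 2 ^ p)\<bar> \<le> 1 ^ length ds"
    by (intro abs_prod_list_le_power)
  then have "hat_prod p m x * \<bar>\<Prod>i\<leftarrow>ds. max 0 (x $ i - real (m i - 1) / 2 ^ p)\<bar> \<le> 1 * 1"
    using hat_prod_bounds[of p m x] by (intro mult_mono) auto
  then show ?thesis using hat_prod_bounds(1)[of p m x] by (simp add: local_term_def abs_mult)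
qed

text \<open>The digits encode |c|/4, and the output edge supplies the sign and the factor 4. The
  multiplication error 1/4^T per factor is weakened to 1/2^T to join the digit error.\<close>

lemma signed_term_approx:
  fixes ds :: "'d::finite list"
  assumes x: "x \<in> cbox 0 One" and ds: "length ds \<le> n"
    and b: "\<bar>bits_val b T - \<bar>c\<bar> / 4\<bar> \<le> 1 / 2 ^ T"
  shows "\<bar>(if 0 \<le> c then 4 else - 4) * term_net_val p T m ds b (coords x) - c * local_term p m ds x\<bar>
      \<le> 4 * (CARD('d) + n + 1) / 2 ^ T"
proof -
  let ?s = "if 0 \<le> c then 4 else - 4 :: real" and ?F = "term_net_val p T m ds b (coords x)"
    and ?b = "bits_val b T" and ?l = "local_term p m ds x"
  have "?s * ?F - c * ?l = ?s * ((?F - ?b * ?l) + (?b - \<bar>c\<bar> / 4) * ?l)"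
    by (cases "0 \<le> c") (simp_all add: algebra_simps)
  then have "\<bar>?s * ?F - c * ?l\<bar> = 4 * \<bar>(?F - ?b * ?l) + (?b - \<bar>c\<bar> / 4) * ?l\<bar>"
    by (simp add: abs_mult)
  also have "\<dots> \<le> 4 * (\<bar>?F - ?b * ?l\<bar> + \<bar>(?b - \<bar>c\<bar> / 4) * ?l\<bar>)"
    by (intro mult_left_mono abs_triangle_ineq) auto
  also have "\<dots> \<le> 4 * ((CARD('d) + n) / 2 ^ T + 1 / 2 ^ T)"
  proof (intro mult_left_mono add_mono)
    have "\<bar>?F - ?b * ?l\<bar> \<le> (CARD('d) + length ds) / 4 ^ T"
      by (rule term_net_val_approx[OF x])
    also have "\<dots> \<le> (CARD('d) + n) / 2 ^ T"
      using ds by (intro frac_le power_mono) auto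
    finally show "\<bar>?F - ?b * ?l\<bar> \<le> (CARD('d) + n) / 2 ^ T" .
    have "\<bar>?b - \<bar>c\<bar> / 4\<bar> * \<bar>?l\<bar> \<le> 1 / 2 ^ T * 1"
      using b abs_local_term_le[OF x, of p m ds] by (intro mult_mono) auto
    then show "\<bar>(?b - \<bar>c\<bar> / 4) * ?l\<bar> \<le> 1 / 2 ^ T" by (simp add: abs_mult)
  qed auto
  finally show ?thesis by (simp add: add_divide_distrib)
qed

text \<open>The bounds carry p + 1 in place of p so that they also hold at p = 0.\<close>

lemma networks_of_resolution:
  assumes n: "n \<ge> 1"
  obtains C1 C2 C3 :: real where "C1 \<ge> 1" "C2 \<ge> 0" "C3 \<ge> 0"
    "\<And>p. \<exists>A. wf_arch CARD('d::finite) A \<and> real (depth A) \<le> C2 * real (p + 1) \<and>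
       real (num_weights A) \<le> C3 * real (p + 1) * 2 ^ (p * CARD('d)) \<and>
       (\<forall>f \<in> (sobolev_ball n :: (real ^ 'd \<Rightarrow> real) set). continuous_on (cbox 0 One) f \<longrightarrow>
          (\<exists>W B. weight_values A W B \<subseteq> {1 / 4, - 1 / 4} \<and>
             (\<forall>x \<in> cbox (0 :: real ^ 'd) One. \<bar>net_out A W B x - f x\<bar> \<le> C1 / 2 ^ (p * n))))"
proof -
  let ?d = "CARD('d)"
  define K where "K = ?d + n"
  define Lc where "Lc = card {ds :: 'd list. length ds < n}"
  \<comment> \<open>This is \<open>w\<close> below, with its parts replaced by the factors of p + 1
    in their upper bounds.\<close>
  define wc where "wc = (9 * K + 94) + K * ((9 * K + 94) + 4 * (K * (K + 7)) + 54 * K + 102) + 4 * (K * (K + 7))"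
  define C1 where "C1 = 1 + (2 * real ?d) ^ n + real (2 ^ ?d * Lc) * (4 * real (K + 1))"
  define C2 where "C2 = K + 10 + K * (K + 7)"
  define C3 where "C3 = 272 * ?d + 16 * (2 ^ ?d * Lc * wc) + 16 * (2 ^ ?d * Lc)"
  have finL: "finite {ds :: 'd list. length ds < n}"
  proof (rule finite_subset)
    show "{ds :: 'd list. length ds < n} \<subseteq> {ds. set ds \<subseteq> UNIV \<and> length ds \<le> n}" by auto
  qed (rule finite_lists_length_le, simp)
  have main: "\<exists>A. wf_arch ?d A \<and> depth A \<le> C2 * (p + 1) \<and>
       num_weights A \<le> C3 * (p + 1) * 2 ^ (p * ?d) \<and>
       (\<forall>f \<in> (sobolev_ball n :: (real ^ 'd \<Rightarrow> real) set). continuous_on (cbox 0 One) f \<longrightarrow>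
          (\<exists>W B. weight_values A W B \<subseteq> {1 / 4, - 1 / 4} \<and>
             (\<forall>x \<in> cbox (0 :: real ^ 'd) One. \<bar>net_out A W B x - f x\<bar> \<le> C1 / 2 ^ (p * n))))" for p :: nat
  proof -
    \<comment> \<open>There are O(2^(pd)) terms, each with error O(2^(-T)); with K = d + n the total
      is O(2^(-pn)).\<close>
    define T where "T = p * K"
    define I where "I = (grid p :: ('d \<Rightarrow> nat) set) \<times> {ds :: 'd list. length ds < n}"
    define M where "M = card I"
    have finI: "finite I" unfolding I_def using finite_grid finL by blast
    have M: "M \<le> 2 ^ ?d * Lc * 2 ^ (p * ?d)"
    proof -
      have "M = (2 ^ p + 1) ^ ?d * Lc"
        unfolding M_def I_def Lc_def by (simp add: card_cartesian_product card_grid)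
      also have "\<dots> \<le> (2 * 2 ^ p) ^ ?d * Lc" by (intro mult_right_mono power_mono) auto
      also have "\<dots> = 2 ^ ?d * Lc * 2 ^ (p * ?d)" by (simp add: power_mult_distrib power_mult)
      finally show ?thesis .
    qed
    have "((\<lambda>_. 0), []) \<in> I" using n by (simp add: I_def mem_grid_iff)
    then have M1: "M \<ge> 1" unfolding M_def using finI by (metis card_gt_0_iff empty_iff Suc_leI One_nat_def)
    obtain h where h: "bij_betw h {..<M} I"
      using ex_bij_betw_nat_finite[OF finI] unfolding M_def atLeast0LessThan by blast
    have hI: "fst (h t) \<in> grid p" "length (snd (h t)) < n" if "t < M" for t
      using bij_betwE[OF h] that by (auto simp: I_def mem_Times_iff)
    define D where "D = T + 2 * p + 6 + K * (T + 7)"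
    define w0 where "w0 = 9 * T + 33 * p + 94"
    define w where "w = w0 + K * (w0 + 4 * (K * (T + 7)) + 54 * T + 102) + 4 * (K * (T + 7))"
    \<comment> \<open>The parameter of the network family is the whole digit table \<open>b\<close>,
      whose row t encodes the coefficient of term t; it is fixed only after the
      architecture.\<close>
    define F where "F t b = term_net_val p T (fst (h t)) (snd (h t)) (b t)" for t and b :: "nat \<Rightarrow> nat \<Rightarrow> bool"
    have cmp: "computes ?d 1 D w (\<lambda>b xs. [F t b xs])" if "t < M" for t
      unfolding F_def D_def w_def w0_def
      by (rule computes_term_net) (use hI[OF that] in \<open>auto simp: K_def\<close>)
    have D1: "D \<ge> 1" by (simp add: D_def)
    obtain A where AA: "wf_arch ?d A \<and> depth A = D + 4 \<and>
      num_weights A \<le> 272 * ?d + 16 * (M * w) + 16 * M \<and>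
      (\<forall>b s. \<exists>W B. weight_values A W B \<subseteq> {1 / 4, - 1 / 4} \<and>
        (\<forall>x :: real ^ 'd. (\<forall>i. 0 \<le> x $ i) \<longrightarrow>
           net_out A W B x = (\<Sum>t<M. (if s t then 4 else - 4) * F t b (coords x))))"
      using computes_imp_arch[OF cmp M1 D1] by (rule exE)
    note A = AA[THEN conjunct1] AA[THEN conjunct2, THEN conjunct1]
      AA[THEN conjunct2, THEN conjunct2, THEN conjunct1]
      AA[THEN conjunct2, THEN conjunct2, THEN conjunct2, rule_format]
    have T: "T \<le> K * (p + 1)" "T + 7 \<le> (K + 7) * (p + 1)" by (auto simp: T_def algebra_simps)
    have KT: "K * (T + 7) \<le> K * (K + 7) * (p + 1)"
      unfolding mult.assoc by (rule mult_left_mono[OF T(2)]) simp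
    have w0: "w0 \<le> (9 * K + 94) * (p + 1)" by (simp add: w0_def T_def algebra_simps)
    have "w0 + 4 * (K * (T + 7)) + 54 * T + 102 \<le> ((9 * K + 94) + 4 * (K * (K + 7)) + 54 * K + 102) * (p + 1)"
    proof -
      have "102 \<le> 102 * (p + 1)" by simp
      then show ?thesis using w0 KT T(1) unfolding add_mult_distrib mult.assoc by linarith
    qed
    then have "K * (w0 + 4 * (K * (T + 7)) + 54 * T + 102) \<le> K * (((9 * K + 94) + 4 * (K * (K + 7)) + 54 * K + 102) * (p + 1))"
      by (rule mult_left_mono) simp
    then have w: "w \<le> wc * (p + 1)"
      unfolding w_def wc_def using w0 KT by (simp only: add_mult_distrib mult.assoc)
    have depth: "depth A \<le> C2 * (p + 1)"
    proof -
      have "depth A = T + (2 * p + 10) + K * (T + 7)" by (simp only: A(2) D_def)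
      also have "\<dots> \<le> K * (p + 1) + 10 * (p + 1) + K * (K + 7) * (p + 1)"
        by (intro add_mono T(1) KT) simp
      finally show ?thesis by (simp only: C2_def add_mult_distrib)
    qed
    have weights: "num_weights A \<le> C3 * (p + 1) * 2 ^ (p * ?d)"
    proof -
      let ?N = "2 ^ ?d * Lc" and ?q = "2 ^ (p * ?d) :: nat"
      have "0 < (p + 1) * ?q" by simp
      then have q: "1 \<le> (p + 1) * ?q" by (simp only: One_nat_def Suc_le_eq)
      have M': "M \<le> ?N * ((p + 1) * ?q)"
        using M by (rule order_trans) (simp add: algebra_simps)
      have "num_weights A \<le> 272 * ?d * 1 + 16 * (M * w) + 16 * M" using A(3) by simp
      also have "\<dots> \<le> 272 * ?d * ((p + 1) * ?q) + 16 * ((?N * ?q) * (wc * (p + 1))) + 16 * (?N * ((p + 1) * ?q))"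
        by (intro add_mono mult_left_mono q mult_mono[OF M w] M') simp_all
      also have "\<dots> = C3 * (p + 1) * ?q" unfolding C3_def by (simp add: algebra_simps)
      finally show ?thesis .
    qed
    have approx: "\<exists>W B. weight_values A W B \<subseteq> {1 / 4, - 1 / 4} \<and>
             (\<forall>x \<in> cbox (0 :: real ^ 'd) One. \<bar>net_out A W B x - f x\<bar> \<le> C1 / 2 ^ (p * n))"
      if f: "f \<in> sobolev_ball n" "continuous_on (cbox 0 One) f" for f :: "real ^ 'd \<Rightarrow> real"
    proof -
      obtain c where c: "\<And>m ds. \<bar>c m ds\<bar> \<le> 1"
        "\<And>x. x \<in> cbox 0 One \<Longrightarrow>
          \<bar>f x - (\<Sum>m\<in>grid p. \<Sum>ds | length ds < n. c m ds * local_term p m ds x)\<bar>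
            \<le> (1 + (2 * ?d) ^ n) / 2 ^ (p * n)"
        using sobolev_local_approx[OF f, of p] by blast
      define ct where "ct t = c (fst (h t)) (snd (h t))" for t
      have "\<exists>\<beta>. \<bar>bits_val \<beta> T - \<bar>ct t\<bar> / 4\<bar> \<le> 1 / 2 ^ T" for t
        using c(1) by (intro bits_val_approx) (auto simp: ct_def)
      then obtain b where b: "\<And>t. \<bar>bits_val (b t) T - \<bar>ct t\<bar> / 4\<bar> \<le> 1 / 2 ^ T" by metis
      obtain W B where WB: "weight_values A W B \<subseteq> {1 / 4, - 1 / 4}"
        "\<And>x :: real ^ 'd. (\<forall>i. 0 \<le> x $ i) \<Longrightarrow>
           net_out A W B x = (\<Sum>t<M. (if 0 \<le> ct t then 4 else - 4) * F t b (coords x))"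
        using A(4)[of "\<lambda>t. 0 \<le> ct t" b] by blast
      have "\<bar>net_out A W B x - f x\<bar> \<le> C1 / 2 ^ (p * n)" if x: "x \<in> cbox 0 One" for x
      proof -
        let ?l = "\<lambda>t. local_term p (fst (h t)) (snd (h t)) x"
        have "(\<Sum>m\<in>grid p. \<Sum>ds | length ds < n. c m ds * local_term p m ds x)
            = (\<Sum>(m, ds)\<in>I. c m ds * local_term p m ds x)"
          unfolding I_def by (rule sum.cartesian_product)
        also have "\<dots> = (\<Sum>t<M. ct t * ?l t)"
          by (subst sum.reindex_bij_betw[OF h, symmetric]) (simp add: ct_def split_beta)
        finally have s: "(\<Sum>m\<in>grid p. \<Sum>ds | length ds < n. c m ds * local_term p m ds x) = (\<Sum>t<M. ct t * ?l t)" .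
        have "net_out A W B x - (\<Sum>t<M. ct t * ?l t)
            = (\<Sum>t<M. (if 0 \<le> ct t then 4 else - 4) * F t b (coords x) - ct t * ?l t)"
          using x by (subst WB(2)) (auto simp: mem_unit_cube_iff sum_subtractf)
        also have "\<bar>\<dots>\<bar> \<le> (\<Sum>t<M. 4 * real (K + 1) / 2 ^ T)"
        proof (rule order_trans[OF sum_abs sum_mono])
          fix t assume "t \<in> {..<M}"
          then have "length (snd (h t)) \<le> n" using hI(2)[of t] by simp
          from signed_term_approx[OF x this b[of t], of p "fst (h t)"]
          show "\<bar>(if 0 \<le> ct t then 4 else - 4) * F t b (coords x) - ct t * ?l t\<bar> \<le> 4 * real (K + 1) / 2 ^ T"
            by (simp add: F_def K_def)
        qed
        also have "\<dots> = real M * (4 * real (K + 1)) / 2 ^ T" by simp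
        also have "\<dots> \<le> real (2 ^ ?d * Lc * 2 ^ (p * ?d)) * (4 * real (K + 1)) / 2 ^ T"
          using M by (intro divide_right_mono mult_right_mono of_nat_mono) auto
        also have "\<dots> = real (2 ^ ?d * Lc) * (4 * real (K + 1)) / 2 ^ (p * n)"
          by (simp add: T_def K_def add_mult_distrib2 power_add)
        finally have "\<bar>net_out A W B x - (\<Sum>t<M. ct t * ?l t)\<bar> \<le> real (2 ^ ?d * Lc) * (4 * real (K + 1)) / 2 ^ (p * n)" .
        moreover note c(2)[OF x, unfolded s]
        moreover have "C1 / 2 ^ (p * n) = (1 + (2 * ?d) ^ n) / 2 ^ (p * n) + real (2 ^ ?d * Lc) * (4 * real (K + 1)) / 2 ^ (p * n)"
          by (simp add: C1_def add_divide_distrib)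
        ultimately show ?thesis by linarith
      qed
      then show ?thesis using WB(1) by blast
    qed
    show ?thesis using A(1) depth weights approx by blast
  qed
  show ?thesis
  proof (rule that[of C1 "real C2" "real C3"])
    fix p
    obtain A where "wf_arch ?d A" "depth A \<le> C2 * (p + 1)" "num_weights A \<le> C3 * (p + 1) * 2 ^ (p * ?d)"
       "\<forall>f \<in> (sobolev_ball n :: (real ^ 'd \<Rightarrow> real) set). continuous_on (cbox 0 One) f \<longrightarrow>
          (\<exists>W B. weight_values A W B \<subseteq> {1 / 4, - 1 / 4} \<and>
             (\<forall>x \<in> cbox (0 :: real ^ 'd) One. \<bar>net_out A W B x - f x\<bar> \<le> C1 / 2 ^ (p * n)))"
      using main by blast
    moreover have "real (depth A) \<le> real C2 * real (p + 1)"
      using \<open>depth A \<le> C2 * (p + 1)\<close> by (metis of_nat_le_iff of_nat_mult)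
    moreover have "real (num_weights A) \<le> real C3 * real (p + 1) * 2 ^ (p * ?d)"
      using \<open>num_weights A \<le> C3 * (p + 1) * 2 ^ (p * ?d)\<close>
      by (metis of_nat_le_iff of_nat_mult of_nat_numeral of_nat_power)
    ultimately show "\<exists>A. wf_arch ?d A \<and> real (depth A) \<le> real C2 * real (p + 1) \<and>
       real (num_weights A) \<le> real C3 * real (p + 1) * 2 ^ (p * ?d) \<and>
       (\<forall>f \<in> (sobolev_ball n :: (real ^ 'd \<Rightarrow> real) set). continuous_on (cbox 0 One) f \<longrightarrow>
          (\<exists>W B. weight_values A W B \<subseteq> {1 / 4, - 1 / 4} \<and>
             (\<forall>x \<in> cbox (0 :: real ^ 'd) One. \<bar>net_out A W B x - f x\<bar> \<le> C1 / 2 ^ (p * n))))" by blast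
  qed (auto simp: C1_def)
qed

section \<open>Choice of the grid resolution\<close>

lemma resolution_exists:
  fixes C1 \<epsilon> :: real
  assumes n: "n \<ge> 1" and C1: "C1 \<ge> 1" and \<epsilon>: "0 < \<epsilon>" "\<epsilon> < 1"
  obtains p where "C1 / 2 ^ (p * n) \<le> \<epsilon>"
    "\<epsilon> < 1 / 2 \<Longrightarrow> real (p + 1) \<le> (log 2 C1 + 3) * log 2 (1 / \<epsilon>)"
    "\<And>d. 2 ^ (p * d) \<le> 2 ^ d * C1 powr (real d / real n) * (1 / \<epsilon>) powr (real d / real n)"
proof -
  obtain k where k: "C1 / \<epsilon> < 2 ^ k" using real_arch_pow[of 2 "C1 / \<epsilon>"] by auto
  have "(2::real) ^ k \<le> 2 ^ (k * n)" using n by (intro power_increasing) auto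
  then have "C1 / \<epsilon> < 2 ^ (k * n)" using k by linarith
  then have "C1 / 2 ^ (k * n) \<le> \<epsilon>" using \<epsilon> by (simp add: field_simps)
  \<comment> \<open>Minimality means that p - 1 fails, that is 2^((p-1)n) < C1/\<epsilon>; both
    upper bounds follow from this.\<close>
  define p where "p = (LEAST p. C1 / 2 ^ (p * n) \<le> \<epsilon>)"
  have p: "C1 / 2 ^ (p * n) \<le> \<epsilon>" unfolding p_def by (rule LeastI) fact
  have "p \<noteq> 0" using p C1 \<epsilon> by (intro notI) simp
  then obtain q where q: "p = Suc q" by (cases p) auto
  have "\<not> C1 / 2 ^ (q * n) \<le> \<epsilon>" using not_less_Least[of q] q by (metis lessI p_def)
  then have q2: "2 ^ (q * n) < C1 / \<epsilon>" using \<epsilon> by (simp add: field_simps)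
  show ?thesis
  proof (rule that[OF p])
    \<comment> \<open>Now the logarithm exceeds 1 and absorbs the additive constants.\<close>
    assume e: "\<epsilon> < 1 / 2"
    have "log 2 2 < log 2 (1 / \<epsilon>)" using e \<epsilon> by (subst log_less_cancel_iff) (auto simp: field_simps)
    then have L: "1 < log 2 (1 / \<epsilon>)" by simp
    have "real q \<le> real (q * n)" using n by (simp only: of_nat_le_iff) simp
    also have "\<dots> = log 2 (2 ^ (q * n))" by simp
    also have "\<dots> \<le> log 2 (C1 * (1 / \<epsilon>))" using q2 C1 \<epsilon> by (subst log_le_cancel_iff) auto
    also have "\<dots> = log 2 C1 + log 2 (1 / \<epsilon>)" using C1 \<epsilon> by (subst log_mult) auto
    finally have "real (p + 1) \<le> log 2 C1 * 1 + 2 * 1 + log 2 (1 / \<epsilon>)" by (simp add: q)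
    also have "\<dots> \<le> log 2 C1 * log 2 (1 / \<epsilon>) + 2 * log 2 (1 / \<epsilon>) + log 2 (1 / \<epsilon>)"
      using L C1 by (intro add_mono mult_left_mono) auto
    finally show "real (p + 1) \<le> (log 2 C1 + 3) * log 2 (1 / \<epsilon>)" by (simp add: algebra_simps)
  next
    fix d
    have "(2::real) ^ (q * d) = (2 ^ (q * n)) powr (real d / real n)"
      using n by (simp add: powr_realpow[symmetric] powr_powr)
    also have "\<dots> \<le> (C1 * (1 / \<epsilon>)) powr (real d / real n)" using q2 by (intro powr_mono2) auto
    also have "\<dots> = C1 powr (real d / real n) * (1 / \<epsilon>) powr (real d / real n)"
      using C1 \<epsilon> by (subst powr_mult) auto
    finally show "2 ^ (p * d) \<le> 2 ^ d * C1 powr (real d / real n) * (1 / \<epsilon>) powr (real d / real n)"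
      by (simp add: q power_add)
  qed
qed

text \<open>Continuity selects the representative of f: membership in \<open>sobolev_ball\<close>
  survives a change of f at a single point or on the boundary, while the error is measured at every
  point of the closed cube.\<close>

theorem theorem1:
  fixes n :: nat
  assumes "n \<ge> 1"
  shows "\<exists>C \<epsilon>0::real. C > 0 \<and> 0 < \<epsilon>0 \<and> \<epsilon>0 \<le> 1 \<and>
    (\<forall>lam::nat. lam \<ge> 2 \<longrightarrow> (\<forall>\<epsilon>::real. 0 < \<epsilon> \<and> \<epsilon> < 1 \<longrightarrow>
      (\<exists>A. wf_arch CARD('d::finite) A \<and>
        (\<forall>f \<in> (sobolev_ball n :: (real^'d \<Rightarrow> real) set). continuous_on (cbox 0 One) f \<longrightarrow>
           (\<exists>W B. card (weight_values A W B) \<le> lam \<and>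
                  (\<forall>x\<in>cbox (0::real^'d) One. \<bar>net_out A W B x - f x\<bar> \<le> \<epsilon>))) \<and>
        (\<epsilon> < \<epsilon>0 \<longrightarrow>
           real (depth A) \<le> C * (real lam * log 2 (1/\<epsilon>) powr (1 / (real lam - 1)) + log 2 (1/\<epsilon>)) \<and>
           real (num_weights A) \<le> C * (real lam * log 2 (1/\<epsilon>) powr (1 / (real lam - 1) + 1)
                                       * (1/\<epsilon>) powr (real CARD('d) / real n)) \<and>
           num_bits lam A \<le> C * (real lam * log 2 (real lam) * log 2 (1/\<epsilon>) powr (1 / (real lam - 1) + 1)
                                       * (1/\<epsilon>) powr (real CARD('d) / real n))))))"
proof -
  let ?d = "CARD('d)"
  obtain C1 C2 C3 :: real where C: "C1 \<ge> 1" "C2 \<ge> 0" "C3 \<ge> 0"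
    and nets: "\<And>p. \<exists>A. wf_arch ?d A \<and> real (depth A) \<le> C2 * real (p + 1) \<and>
       real (num_weights A) \<le> C3 * real (p + 1) * 2 ^ (p * ?d) \<and>
       (\<forall>f \<in> (sobolev_ball n :: (real ^ 'd \<Rightarrow> real) set). continuous_on (cbox 0 One) f \<longrightarrow>
          (\<exists>W B. weight_values A W B \<subseteq> {1 / 4, - 1 / 4} \<and>
             (\<forall>x \<in> cbox (0 :: real ^ 'd) One. \<bar>net_out A W B x - f x\<bar> \<le> C1 / 2 ^ (p * n))))"
    using networks_of_resolution[OF assms, where 'd = 'd] by metis
  define r where "r = real ?d / real n"
  define q where "q = log 2 C1 + 3"
  have q: "q > 0" using C(1) by (simp add: q_def add_nonneg_pos)
  define C' where "C' = 1 + C2 * q + C3 * q * (2 ^ ?d * C1 powr r)"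
  have C': "C' > 0" "C2 * q \<le> C'" "C3 * q * (2 ^ ?d * C1 powr r) \<le> C'"
    using C q by (auto simp: C'_def add_pos_nonneg)
  show ?thesis
  \<comment> \<open>The threshold 1/2 makes log(1/\<epsilon>) at least 1 where the size bounds are
    claimed; the approximation is proved for every \<epsilon> below 1.\<close>
  proof (rule exI[of _ C'], rule exI[of _ "1 / 2"], intro conjI allI impI)
    fix lam :: nat and \<epsilon> :: real assume lam: "lam \<ge> 2" and \<epsilon>: "0 < \<epsilon> \<and> \<epsilon> < 1"
    let ?L = "log 2 (1 / \<epsilon>)"
    obtain p where p: "C1 / 2 ^ (p * n) \<le> \<epsilon>" "\<epsilon> < 1 / 2 \<Longrightarrow> real (p + 1) \<le> q * ?L"
      "\<And>d. 2 ^ (p * d) \<le> 2 ^ d * C1 powr (real d / real n) * (1 / \<epsilon>) powr (real d / real n)"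
      using resolution_exists[OF assms C(1), of \<epsilon>] \<epsilon> unfolding q_def by metis
    obtain A where A: "wf_arch ?d A" "real (depth A) \<le> C2 * real (p + 1)"
       "real (num_weights A) \<le> C3 * real (p + 1) * 2 ^ (p * ?d)"
       "\<And>f. f \<in> (sobolev_ball n :: (real ^ 'd \<Rightarrow> real) set) \<Longrightarrow> continuous_on (cbox 0 One) f \<Longrightarrow>
          \<exists>W B. weight_values A W B \<subseteq> {1 / 4, - 1 / 4} \<and>
             (\<forall>x \<in> cbox (0 :: real ^ 'd) One. \<bar>net_out A W B x - f x\<bar> \<le> C1 / 2 ^ (p * n))"
      using nets[of p] by blast
    have approx: "\<exists>W B. card (weight_values A W B) \<le> lam \<and>
                  (\<forall>x\<in>cbox (0::real^'d) One. \<bar>net_out A W B x - f x\<bar> \<le> \<epsilon>)"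
      if f: "f \<in> (sobolev_ball n :: (real ^ 'd \<Rightarrow> real) set)" "continuous_on (cbox 0 One) f" for f
    proof -
      obtain W B where WB: "weight_values A W B \<subseteq> {1 / 4, - 1 / 4}"
        "\<forall>x \<in> cbox (0 :: real ^ 'd) One. \<bar>net_out A W B x - f x\<bar> \<le> C1 / 2 ^ (p * n)"
        using A(4)[OF f] by blast
      have "card (weight_values A W B) \<le> card {1 / 4, - 1 / 4 :: real}" by (rule card_mono[OF _ WB(1)]) simp
      also have "\<dots> \<le> lam" using lam by simp
      finally show ?thesis using WB(2) p(1) by (meson order_trans)
    qed
    have bounds: "real (depth A) \<le> C' * (real lam * ?L powr (1 / (real lam - 1)) + ?L) \<and>
        real (num_weights A) \<le> C' * (real lam * ?L powr (1 / (real lam - 1) + 1) * (1 / \<epsilon>) powr r) \<and>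
        num_bits lam A \<le> C' * (real lam * log 2 (real lam) * ?L powr (1 / (real lam - 1) + 1) * (1 / \<epsilon>) powr r)"
      if e: "\<epsilon> < 1 / 2"
    proof (intro conjI)
      have "log 2 2 < ?L" using e \<epsilon> by (subst log_less_cancel_iff) (auto simp: field_simps)
      then have L: "1 \<le> ?L" by simp
      have "real (depth A) \<le> C2 * (q * ?L)"
        using A(2) mult_left_mono[OF p(2)[OF e] C(2)] by linarith
      also have "\<dots> \<le> C' * (real lam * ?L powr (1 / (real lam - 1)) + ?L)"
        unfolding mult.assoc[symmetric] using C' L by (intro mult_mono) auto
      finally show "real (depth A) \<le> C' * (real lam * ?L powr (1 / (real lam - 1)) + ?L)" .
      have "?L = 1 * ?L powr 1" using L by simp
      also have "\<dots> \<le> real lam * ?L powr (1 / (real lam - 1) + 1)"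
        using L lam by (intro mult_mono powr_mono) auto
      finally have L2: "?L \<le> real lam * ?L powr (1 / (real lam - 1) + 1)" .
      have "real (num_weights A) \<le> C3 * real (p + 1) * 2 ^ (p * ?d)" by (rule A(3))
      also have "\<dots> \<le> C3 * (q * ?L) * (2 ^ ?d * C1 powr r * (1 / \<epsilon>) powr r)"
        using C(3) p(2)[OF e] p(3)[of ?d] L q unfolding r_def by (intro mult_mono mult_left_mono) auto
      also have "\<dots> = (C3 * q * (2 ^ ?d * C1 powr r)) * (?L * (1 / \<epsilon>) powr r)" by (simp add: mult_ac)
      also have "\<dots> \<le> C' * (real lam * ?L powr (1 / (real lam - 1) + 1) * (1 / \<epsilon>) powr r)"
        using C' L L2 by (intro mult_mono mult_right_mono) auto
      finally show w: "real (num_weights A) \<le> C' * (real lam * ?L powr (1 / (real lam - 1) + 1) * (1 / \<epsilon>) powr r)" .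
      have "0 \<le> log 2 (real lam)" using lam by simp
      from mult_left_mono[OF w this]
      show "num_bits lam A \<le> C' * (real lam * log 2 (real lam) * ?L powr (1 / (real lam - 1) + 1) * (1 / \<epsilon>) powr r)"
        unfolding num_bits_def by (simp add: mult_ac)
    qed
    show "\<exists>A. wf_arch CARD('d::finite) A \<and>
        (\<forall>f \<in> (sobolev_ball n :: (real^'d \<Rightarrow> real) set). continuous_on (cbox 0 One) f \<longrightarrow>
           (\<exists>W B. card (weight_values A W B) \<le> lam \<and>
                  (\<forall>x\<in>cbox (0::real^'d) One. \<bar>net_out A W B x - f x\<bar> \<le> \<epsilon>))) \<and>
        (\<epsilon> < 1 / 2 \<longrightarrow>
           real (depth A) \<le> C' * (real lam * log 2 (1/\<epsilon>) powr (1 / (real lam - 1)) + log 2 (1/\<epsilon>)) \<and>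
           real (num_weights A) \<le> C' * (real lam * log 2 (1/\<epsilon>) powr (1 / (real lam - 1) + 1)
                                       * (1/\<epsilon>) powr (real CARD('d) / real n)) \<and>
           num_bits lam A \<le> C' * (real lam * log 2 (real lam) * log 2 (1/\<epsilon>) powr (1 / (real lam - 1) + 1)
                                       * (1/\<epsilon>) powr (real CARD('d) / real n)))"
      using A(1) approx bounds unfolding r_def by blast
  qed (use C'(1) in auto)
qed

end
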